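(* For any two $n$-mode raw LOPP-circuits $C_1,C_2$, one has $\mathrm{LOPP}\vdash C_1=C_2$ if and only if $[\![C_1]\!]=[\![C_2]\!]$.
   Context: Raw LOPP-circuits are terms generated from the following generators, with their numbers of modes (inputs = outputs): the phase shifter $\mathrm{ph}(\varphi)$ on $1$ mode for each $\varphi\in\mathbb R$; the beam splitter $\mathrm{bs}(\theta)$ on $2$ modes for each $\theta\in\mathbb R$; the identity wire $\mathrm{id}$ on $1$ mode; the swap $\mathrm{sw}$ on $2$ modes; and the empty circuit $e$ on $0$ modes. They are combined by sequential composition $C_2\circ C_1$, defined when both act on the same number of modes, and by parallel composition $C_1\otimes C_2$, in which the modes of $C_1$ are placed above those of $C_2$. Semantics. To an $n$-mode raw circuit one associates an $n\times n$ matrix $[\![\cdot]\!]$, with $[\![C_2\circ C_1]\!]=[\![C_2]\!][\![C_1]\!]$ and $[\![C_1\otimes C_3]\!]=[\![C_1]\!]\oplus[\![C_3]\!]$ (block-diagonal). On generators: $[\![\mathrm{ph}(\varphi)]\!]=(e^{i\varphi})$, $[\![\mathrm{bs}(\theta)]\!]=\begin{pmatrix}\cos\theta&i\sin\theta\\ i\sin\theta&\cos\theta\end{pmatrix}$, $[\![\mathrm{sw}]\!]=\begin{pmatrix}0&1\\1&0\end{pmatrix}$, $[\![\mathrm{id}]\!]=(1)$, and $[\![e]\!]$ is the map on $\mathbb C^0$. Notation. Set $id_0=e$ and $id_{k+1}=id_k\otimes\mathrm{id}$. Set $\sigma_0=\mathrm{id}$ and $\sigma_{k+1}=(\mathrm{sw}\otimes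 id_k)\circ(\mathrm{id}\otimes\sigma_k)$. Modes are numbered $0,1,2,\dots$ from top to bottom. Definition of $\mathrm{LOPP}\vdash C_1=C_2$. It is the smallest equivalence relation on raw circuits that is a congruence for $\circ$ and $\otimes$ and contains the structural axioms and axioms (A)–(G) below, for all circuits and angles for which both sides are defined. Structural axioms: - $id_k\circ C=C=C\circ id_k$; - $(C_3\circ C_2)\circ C_1=C_3\circ(C_2\circ C_1)$; - $e\otimes C=C=C\otimes e$; - $(C_1\otimes C_2)\otimes C_3=C_1\otimes(C_2\otimes C_3)$; - $(C_2\circ C_1)\otimes(C_4\circ C_3)=(C_2\otimes C_4)\circ(C_1\otimes C_3)$; - $\sigma_k\circ(C\otimes\mathrm{id})=(\mathrm{id}\otimes C)\circ\sigma_k$ for every $k$-mode $C$; - $\mathrm{sw}\circ\mathrm{sw}=\mathrm{id}\otimes\mathrm{id}$. Axioms: - (A) $\mathrm{ph}(0)=\mathrm{ph}(2\pi)=\mathrm{id}$. - (B) $\mathrm{bs}(0)=\mathrm{id}\otimes\mathrm{id}$. - (C) $\mathrm{sw}=(\mathrm{ph}(-\pi/2)\otimes\mathrm{ph}(-\pi/2))\circ\mathrm{bs}(\pi/2)$. - (D) $\mathrm{ph}(\varphi_2)\circ\mathrm{ph}(\varphi_1)=\mathrm{ph}(\varphi_1+\varphi_2)$. - (E) $\mathrm{bs}(\theta)\circ(\mathrm{ph}(\varphi)\otimes\mathrm{ph}(\varphi))=(\mathrm{ph}(\varphi)\otimes\mathrm{ph}(\varphi))\circ\mathrm{bs}(\theta)$.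 - (F) For all $\alpha_1,\alpha_2,\alpha_3\in\mathbb R$: $$\mathrm{bs}(\alpha_3)\circ(\mathrm{ph}(\alpha_2)\otimes\mathrm{id})\circ\mathrm{bs}(\alpha_1)=(\mathrm{ph}(\beta_3)\otimes\mathrm{ph}(\beta_4))\circ\mathrm{bs}(\beta_2)\circ(\mathrm{ph}(\beta_1)\otimes\mathrm{id}),$$ where $\beta_1,\dots,\beta_4\in[0,2\pi)$ are the unique angles making the two sides have the same semantics under the constraints $\beta_1,\beta_2\in[0,\pi)$ and ($\beta_2\in\{0,\pi/2\}\Rightarrow\beta_1=0$). - (G) On $3$ modes, write $B_{01}(\theta)=\mathrm{bs}(\theta)\otimes\mathrm{id}$, $B_{12}(\theta)=\mathrm{id}\otimes\mathrm{bs}(\theta)$, $\Phi_0(\varphi)=\mathrm{ph}(\varphi)\otimes\mathrm{id}\otimes\mathrm{id}$, $\Phi_1(\varphi)=\mathrm{id}\otimes\mathrm{ph}(\varphi)\otimes\mathrm{id}$, and $\Phi_2(\varphi)=\mathrm{id}\otimes\mathrm{id}\otimes\mathrm{ph}(\varphi)$. For all $\gamma_1,\dots,\gamma_4\in\mathbb R$: $$B_{01}(\gamma_4)\circ B_{12}(\gamma_3)\circ\Phi_0(\gamma_2)\circ B_{01}(\gamma_1)=\Phi_2(\delta_9)\circ\Phi_1(\delta_8)\circ\Phi_0(\delta_7)\circ B_{12}(\delta_6)\circ\Phi_1(\delta_5)\circ B_{01}(\delta_4)\circ B_{12}(\delta_3)\circ\Phi_0(\delta_2)\circ\Phi_1(\delta_1),$$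 where $\delta_1,\dots,\delta_9\in[0,2\pi)$ are the unique angles making the two sides have the same semantics under the constraints: - $\delta_1,\dots,\delta_6\in[0,\pi)$; - $\delta_3\in\{0,\pi/2\}\Rightarrow\delta_1=0$; - $\delta_4\in\{0,\pi/2\}\Rightarrow\delta_2=0$; - $\delta_4=0\Rightarrow\delta_3=0$; - $\delta_6\in\{0,\pi/2\}\Rightarrow\delta_5=0$. *)

theory Defs
  imports Complex_Main "Jordan_Normal_Form.Matrix"
begin

datatype circ =
    Ph real
  | Bs real
  | Idw
  | Sw
  | E
  | Seq circ circ    (* Seq C2 C1 = C2 o C1 *)
  | Par circ circ    (* Par C1 C2 = C1 (x) C2, C1 on top *)

fun ar :: "circ \<Rightarrow> nat" where
  "ar (Ph _) = 1"
| "ar (Bs _) = 2"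
| "ar Idw = 1"
| "ar Sw = 2"
| "ar E = 0"
| "ar (Seq C2 C1) = ar C1"
| "ar (Par C1 C2) = ar C1 + ar C2"

fun wf :: "circ \<Rightarrow> bool" where
  "wf (Seq C2 C1) = (wf C1 \<and> wf C2 \<and> ar C1 = ar C2)"
| "wf (Par C1 C2) = (wf C1 \<and> wf C2)"
| "wf _ = True"

fun sem :: "circ \<Rightarrow> complex mat" where
  "sem (Ph \<phi>) = mat 1 1 (\<lambda>_. cis \<phi>)"
| "sem (Bs \<theta>) = mat 2 2 (\<lambda>(i,j). if i = j then complex_of_real (cos \<theta>)
                                   else \<i> * complex_of_real (sin \<theta>))"
| "sem Idw = 1\<^sub>m 1"
| "sem Sw = mat 2 2 (\<lambda>(i,j). if i = j then 0 else 1)"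
| "sem E = 1\<^sub>m 0"
| "sem (Seq C2 C1) = sem C2 * sem C1"
| "sem (Par C1 C2) = four_block_mat (sem C1) (0\<^sub>m (dim_row (sem C1)) (dim_col (sem C2)))
                                      (0\<^sub>m (dim_row (sem C2)) (dim_col (sem C1))) (sem C2)"

fun idk :: "nat \<Rightarrow> circ" where
  "idk 0 = E"
| "idk (Suc k) = Par (idk k) Idw"

fun sigma :: "nat \<Rightarrow> circ" where
  "sigma 0 = Idw"
| "sigma (Suc k) = Seq (Par Sw (idk k)) (Par Idw (sigma k))"

definition B01 :: "real \<Rightarrow> circ" where "B01 t = Par (Bs t) Idw"
definition B12 :: "real \<Rightarrow> circ" where "B12 t = Par Idw (Bs t)"
definition Phi0 :: "real \<Rightarrow> circ" where "Phi0 t = Par (Ph t) (Par Idw Idw)"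
definition Phi1 :: "real \<Rightarrow> circ" where "Phi1 t = Par Idw (Par (Ph t) Idw)"
definition Phi2 :: "real \<Rightarrow> circ" where "Phi2 t = Par Idw (Par Idw (Ph t))"

definition F_lhs :: "real \<Rightarrow> real \<Rightarrow> real \<Rightarrow> circ" where
  "F_lhs a1 a2 a3 = Seq (Bs a3) (Seq (Par (Ph a2) Idw) (Bs a1))"

definition F_rhs :: "real \<Rightarrow> real \<Rightarrow> real \<Rightarrow> real \<Rightarrow> circ" where
  "F_rhs b1 b2 b3 b4 = Seq (Par (Ph b3) (Ph b4)) (Seq (Bs b2) (Par (Ph b1) Idw))"

definition F_cond :: "real \<Rightarrow> real \<Rightarrow> real \<Rightarrow> real \<Rightarrow> real \<Rightarrow> real \<Rightarrow> real \<Rightarrow> bool" where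
  "F_cond a1 a2 a3 b1 b2 b3 b4 \<longleftrightarrow>
     (\<forall>b\<in>{b1,b2,b3,b4}. 0 \<le> b \<and> b < 2*pi) \<and>
     b1 < pi \<and> b2 < pi \<and>
     (b2 \<in> {0, pi/2} \<longrightarrow> b1 = 0) \<and>
     sem (F_lhs a1 a2 a3) = sem (F_rhs b1 b2 b3 b4)"

definition G_lhs :: "real \<Rightarrow> real \<Rightarrow> real \<Rightarrow> real \<Rightarrow> circ" where
  "G_lhs g1 g2 g3 g4 = Seq (B01 g4) (Seq (B12 g3) (Seq (Phi0 g2) (B01 g1)))"

definition G_rhs :: "(nat \<Rightarrow> real) \<Rightarrow> circ" where
  "G_rhs d = Seq (Phi2 (d 9)) (Seq (Phi1 (d 8)) (Seq (Phi0 (d 7)) (Seq (B12 (d 6))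
      (Seq (Phi1 (d 5)) (Seq (B01 (d 4)) (Seq (B12 (d 3)) (Seq (Phi0 (d 2)) (Phi1 (d 1)))))))))"

definition G_cond :: "real \<Rightarrow> real \<Rightarrow> real \<Rightarrow> real \<Rightarrow> (nat \<Rightarrow> real) \<Rightarrow> bool" where
  "G_cond g1 g2 g3 g4 d \<longleftrightarrow>
     (\<forall>i\<in>{1..9}. 0 \<le> d i \<and> d i < 2*pi) \<and>
     (\<forall>i\<in>{1..6}. d i < pi) \<and>
     (d 3 \<in> {0, pi/2} \<longrightarrow> d 1 = 0) \<and>
     (d 4 \<in> {0, pi/2} \<longrightarrow> d 2 = 0) \<and>
     (d 4 = 0 \<longrightarrow> d 3 = 0) \<and>
     (d 6 \<in> {0, pi/2} \<longrightarrow> d 5 = 0) \<and>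
     sem (G_lhs g1 g2 g3 g4) = sem (G_rhs d)"

inductive lopp :: "circ \<Rightarrow> circ \<Rightarrow> bool" where
  refl: "wf C \<Longrightarrow> lopp C C"
| sym: "lopp C1 C2 \<Longrightarrow> lopp C2 C1"
| trans: "lopp C1 C2 \<Longrightarrow> lopp C2 C3 \<Longrightarrow> lopp C1 C3"
| cong_seq: "lopp C1 C1' \<Longrightarrow> lopp C2 C2' \<Longrightarrow> wf (Seq C2 C1) \<Longrightarrow> wf (Seq C2' C1')
             \<Longrightarrow> lopp (Seq C2 C1) (Seq C2' C1')"
| cong_par: "lopp C1 C1' \<Longrightarrow> lopp C2 C2' \<Longrightarrow> lopp (Par C1 C2) (Par C1' C2')"
| id_left: "wf C \<Longrightarrow> ar C = k \<Longrightarrow> lopp (Seq (idk k) C) C"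
| id_right: "wf C \<Longrightarrow> ar C = k \<Longrightarrow> lopp (Seq C (idk k)) C"
| seq_assoc: "wf (Seq (Seq C3 C2) C1) \<Longrightarrow>
              lopp (Seq (Seq C3 C2) C1) (Seq C3 (Seq C2 C1))"
| e_left: "wf C \<Longrightarrow> lopp (Par E C) C"
| e_right: "wf C \<Longrightarrow> lopp (Par C E) C"
| par_assoc: "wf C1 \<Longrightarrow> wf C2 \<Longrightarrow> wf C3 \<Longrightarrow>
              lopp (Par (Par C1 C2) C3) (Par C1 (Par C2 C3))"
| interchange: "wf (Seq C2 C1) \<Longrightarrow> wf (Seq C4 C3) \<Longrightarrow>
              lopp (Par (Seq C2 C1) (Seq C4 C3)) (Seq (Par C2 C4) (Par C1 C3))"
| sigma_nat: "wf C \<Longrightarrow> ar C = k \<Longrightarrow>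
              lopp (Seq (sigma k) (Par C Idw)) (Seq (Par Idw C) (sigma k))"
| sw_sw: "lopp (Seq Sw Sw) (Par Idw Idw)"
| ax_A0: "lopp (Ph 0) Idw"
| ax_A2pi: "lopp (Ph (2*pi)) Idw"
| ax_B: "lopp (Bs 0) (Par Idw Idw)"
| ax_C: "lopp Sw (Seq (Par (Ph (-pi/2)) (Ph (-pi/2))) (Bs (pi/2)))"
| ax_D: "lopp (Seq (Ph p2) (Ph p1)) (Ph (p1 + p2))"
| ax_E: "lopp (Seq (Bs t) (Par (Ph p) (Ph p))) (Seq (Par (Ph p) (Ph p)) (Bs t))"
| ax_F: "F_cond a1 a2 a3 b1 b2 b3 b4 \<Longrightarrow> lopp (F_lhs a1 a2 a3) (F_rhs b1 b2 b3 b4)"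
| ax_G: "G_cond g1 g2 g3 g4 d \<Longrightarrow> lopp (G_lhs g1 g2 g3 g4) (G_rhs d)"

end

theory Submission
  imports Defs "Jordan_Normal_Form.Determinant"
begin

text \<open>
  Modulo the axioms, every circuit on \<open>m + 1\<close> modes equals \<open>D \<circ> L \<circ> (id \<otimes> h)\<close>, where \<open>D\<close> is a layer of phase
  shifters, \<open>L\<close> a staircase of \<open>m\<close> beam splitters, and \<open>h\<close> acts on the last \<open>m\<close> modes. Indeed the
  circuits of this form are closed under composition with a generator on the left: a beam splitter
  is pushed through the staircase by axiom (G), or by (F) at the end of the staircase, and
  the phases that arise can be moved either into \<open>D\<close> or into \<open>h\<close>.
  If such a circuit has the identity as its semantics, the top left matrix entry forces the
  first beam splitter of \<open>L\<close> to be diagonal, which makes the circuit equal to some \<open>id \<otimes> h'\<close>, and one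
  concludes by induction on the number of modes. The general case follows since every circuit is
  invertible modulo the axioms.
  The angles in (F) and (G) always exist: a unit row vector in two or three dimensions is the first
  row of a suitable right-hand side, and the remaining rows are determined by unitarity.
\<close>

section \<open>Matrices and soundness\<close>

definition adj :: "complex mat \<Rightarrow> complex mat" where
  "adj A = mat (dim_col A) (dim_row A) (\<lambda>(i, j). cnj (A $$ (j, i)))"

text \<open>One product suffices: a one-sided inverse of a square matrix is two-sided, which
  \<open>unitary_adj_mult\<close> uses to recover the other equation.\<close>

definition unitary :: "nat \<Rightarrow> complex mat \<Rightarrow> bool" where
  "unitary n A \<longleftrightarrow> A \<in> carrier_mat n n \<and> A * adj A = 1\<^sub>m n"

definition dsum :: "complex mat \<Rightarrow> complex mat \<Rightarrow> complex mat" where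
  "dsum A B = four_block_mat A (0\<^sub>m (dim_row A) (dim_col B)) (0\<^sub>m (dim_row B) (dim_col A)) B"

lemma adj_carrier [simp]: "A \<in> carrier_mat n m \<Longrightarrow> adj A \<in> carrier_mat m n"
  by (auto simp: adj_def)

lemma adj_dim [simp]: "dim_row (adj A) = dim_col A" "dim_col (adj A) = dim_row A"
  by (auto simp: adj_def)

lemma adj_index [simp]: "i < dim_col A \<Longrightarrow> j < dim_row A \<Longrightarrow> adj A $$ (i, j) = cnj (A $$ (j, i))"
  by (simp add: adj_def)

lemma adj_adj [simp]: "adj (adj A) = A"
  by (rule eq_matI) auto

lemma adj_one [simp]: "adj (1\<^sub>m n) = 1\<^sub>m n"
  by (rule eq_matI) auto

lemma adj_mult:
  assumes "A \<in> carrier_mat n m" "B \<in> carrier_mat m k"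
  shows "adj (A * B) = adj B * adj A"
  using assms by (intro eq_matI) (auto simp: scalar_prod_def mult.commute)

lemma unitary_carrier: "unitary n A \<Longrightarrow> A \<in> carrier_mat n n"
  by (simp add: unitary_def)

lemma unitary_adj_mult: "unitary n A \<Longrightarrow> adj A * A = 1\<^sub>m n"
  unfolding unitary_def by (meson adj_carrier mat_mult_left_right_inverse)

lemma unitary_adj: "unitary n A \<Longrightarrow> unitary n (adj A)"
  by (simp add: unitary_def unitary_adj_mult[unfolded unitary_def])

lemma unitary_mult:
  assumes "unitary n A" "unitary n B"
  shows "unitary n (A * B)"
proof -
  have c: "A \<in> carrier_mat n n" "B \<in> carrier_mat n n"
    and e: "A * adj A = 1\<^sub>m n" "B * adj B = 1\<^sub>m n"
    using assms by (auto simp: unitary_def)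
  have a: "adj A \<in> carrier_mat n n" "adj B \<in> carrier_mat n n"
    using c by auto
  have "A * B * adj (A * B) = A * B * (adj B * adj A)"
    by (simp only: adj_mult[OF c])
  also have "\<dots> = A * (B * (adj B * adj A))"
    by (rule assoc_mult_mat[of _ n n _ n _ n]) (use c a in auto)
  also have "B * (adj B * adj A) = B * adj B * adj A"
    by (rule assoc_mult_mat[of _ n n _ n _ n, symmetric]) (use c a in auto)
  also have "A * (B * adj B * adj A) = 1\<^sub>m n"
    unfolding e(2) left_mult_one_mat[OF a(1)] by (rule e(1))
  finally show ?thesis
    using c by (simp add: unitary_def)
qed

lemma dsum_dim [simp]:
  "dim_row (dsum A B) = dim_row A + dim_row B"
  "dim_col (dsum A B) = dim_col A + dim_col B"
  by (simp_all add: dsum_def)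

lemma dsum_carrier [simp]:
  "A \<in> carrier_mat n n \<Longrightarrow> B \<in> carrier_mat m m \<Longrightarrow> dsum A B \<in> carrier_mat (n + m) (n + m)"
  by (auto simp: dsum_def)

lemma dsum_index:
  "i < dim_row A + dim_row B \<Longrightarrow> j < dim_col A + dim_col B \<Longrightarrow> dsum A B $$ (i, j) =
    (if i < dim_row A then if j < dim_col A then A $$ (i, j) else 0
     else if j < dim_col A then 0 else B $$ (i - dim_row A, j - dim_col A))"
  by (auto simp: dsum_def)

lemma dsum_mult:
  assumes "A \<in> carrier_mat n n" "A' \<in> carrier_mat n n" "B \<in> carrier_mat m m" "B' \<in> carrier_mat m m"
  shows "dsum A B * dsum A' B' = dsum (A * A') (B * B')"
proof -
  have "dsum A B * dsum A' B' =
    four_block_mat (A * A' + 0\<^sub>m n m * 0\<^sub>m m n) (A * 0\<^sub>m n m + 0\<^sub>m n m * B')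
      (0\<^sub>m m n * A' + B * 0\<^sub>m m n) (0\<^sub>m m n * 0\<^sub>m n m + B * B')"
    using assms unfolding dsum_def by (subst mult_four_block_mat) auto
  also have "\<dots> = dsum (A * A') (B * B')"
    using assms by (auto simp: dsum_def)
  finally show ?thesis .
qed

lemma dsum_adj: "adj (dsum A B) = dsum (adj A) (adj B)"
  by (rule eq_matI) (auto simp: dsum_index)

lemma dsum_one [simp]: "dsum (1\<^sub>m n) (1\<^sub>m m) = 1\<^sub>m (n + m)"
  by (rule eq_matI) (auto simp: dsum_index)

lemma dsum_assoc: "dsum (dsum A B) C = dsum A (dsum B C)"
    (is "?L = ?R")
proof (rule eq_matI)
  \<comment> \<open>A row or column index lies in exactly one of the three blocks; writing it as an
    offset into that block lets both nestings be evaluated by \<open>dsum_index\<close>.\<close>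
  have split: "k < a \<or> (\<exists>l<b. k = a + l) \<or> (\<exists>l<c. k = a + (b + l))"
    if "k < a + (b + c)" for a b c k :: nat
    using that by presburger
  fix i j assume "i < dim_row ?R" "j < dim_col ?R"
  then have "i < dim_row A + (dim_row B + dim_row C)" "j < dim_col A + (dim_col B + dim_col C)"
    by simp_all
  from this[THEN split] show "?L $$ (i, j) = ?R $$ (i, j)"
    by (elim disjE exE conjE) (simp_all add: dsum_index)
qed simp_all

lemma dsum_empty_left [simp]: "dsum (1\<^sub>m 0) A = A"
  by (rule eq_matI) (auto simp: dsum_index)

lemma dsum_empty_right [simp]: "dsum A (1\<^sub>m 0) = A"
  by (rule eq_matI) (auto simp: dsum_index)

lemma unitary_dsum: "unitary n A \<Longrightarrow> unitary m B \<Longrightarrow> unitary (n + m) (dsum A B)"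
  by (auto simp: unitary_def dsum_adj dsum_mult[where n = n and m = m])

text \<open>The four-block expression in the semantics is \<open>dsum\<close> by definition. The
  original equation then leaves the simpset, so that parallel composition always unfolds to
  \<open>dsum\<close>.\<close>

lemma sem_Par [simp]: "sem (Par C1 C2) = dsum (sem C1) (sem C2)"
  by (simp add: dsum_def)

declare sem.simps(7) [simp del]

lemma mult_index2:
  assumes "A \<in> carrier_mat 2 2" "B \<in> carrier_mat 2 2" "i < 2" "j < 2"
  shows "(A * B) $$ (i, j) = A $$ (i, 0) * B $$ (0, j) + A $$ (i, 1) * B $$ (1, j)"
  using assms by (auto simp: scalar_prod_def numeral_2_eq_2)

lemma mult_index3:
  assumes "A \<in> carrier_mat 3 3" "B \<in> carrier_mat 3 3" "i < 3" "j < 3"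
  shows "(A * B) $$ (i, j) = A $$ (i, 0) * B $$ (0, j) + A $$ (i, 1) * B $$ (1, j)
    + A $$ (i, 2) * B $$ (2, j)"
  using assms by (auto simp: scalar_prod_def numeral_3_eq_3 numeral_2_eq_2)

lemma mat_eqI2:
  assumes "A \<in> carrier_mat 2 2" "B \<in> carrier_mat 2 2"
    "A $$ (0, 0) = B $$ (0, 0)" "A $$ (0, 1) = B $$ (0, 1)"
    "A $$ (1, 0) = B $$ (1, 0)" "A $$ (1, 1) = B $$ (1, 1)"
  shows "A = B"
proof (rule eq_matI)
  fix i j assume "i < dim_row B" "j < dim_col B"
  then have "i \<in> {0, 1}" "j \<in> {0, 1}" using assms(2) by auto
  then show "A $$ (i, j) = B $$ (i, j)" using assms(3-6) by blast
qed (use assms in auto)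

lemma mult_eqI2:
  assumes "A \<in> carrier_mat 2 2" "B \<in> carrier_mat 2 2" "C \<in> carrier_mat 2 2"
    "A $$ (0, 0) * B $$ (0, 0) + A $$ (0, 1) * B $$ (1, 0) = C $$ (0, 0)"
    "A $$ (0, 0) * B $$ (0, 1) + A $$ (0, 1) * B $$ (1, 1) = C $$ (0, 1)"
    "A $$ (1, 0) * B $$ (0, 0) + A $$ (1, 1) * B $$ (1, 0) = C $$ (1, 0)"
    "A $$ (1, 0) * B $$ (0, 1) + A $$ (1, 1) * B $$ (1, 1) = C $$ (1, 1)"
  shows "A * B = C"
proof (rule mat_eqI2)
  show "A * B \<in> carrier_mat 2 2" using assms(1,2) by (rule mult_carrier_mat)
qed (use assms in \<open>simp_all only: mult_index2[OF assms(1,2)] pos2 one_less_numeral_iff semiring_norm\<close>)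

lemma sem_Bs_index:
  "i < 2 \<Longrightarrow> j < 2 \<Longrightarrow> sem (Bs t) $$ (i, j) =
    (if i = j then complex_of_real (cos t) else \<i> * complex_of_real (sin t))"
  by simp

lemma sem_Bs_carrier [simp]: "sem (Bs t) \<in> carrier_mat 2 2"
  by simp

lemma cos_sin_mult_self:
  "complex_of_real (cos x) * complex_of_real (cos x)
      + complex_of_real (sin x) * complex_of_real (sin x) = 1"
  by (metis of_real_1 of_real_add of_real_mult power2_eq_square sin_cos_squared_add2)

definition diag2 :: "complex \<Rightarrow> complex \<Rightarrow> complex mat" where
  "diag2 a b = mat 2 2 (\<lambda>(i, j). if i = j then if i = 0 then a else b else 0)"

lemma diag2_carrier [simp]: "diag2 a b \<in> carrier_mat 2 2"
  by (simp add: diag2_def)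

lemma diag2_index: "i < 2 \<Longrightarrow> j < 2 \<Longrightarrow> diag2 a b $$ (i, j) =
    (if i = j then if i = 0 then a else b else 0)"
  by (simp add: diag2_def)

lemma dsum_Ph_Ph: "dsum (sem (Ph a)) (sem (Ph b)) = diag2 (cis a) (cis b)"
  by (rule eq_matI) (auto simp: dsum_index diag2_index diag2_def)

text \<open>Products and block sums preserve unitarity, so only generators need a computation. The
  result supplies the dimensions of \<open>sem C\<close> as well as the unit rows and orthogonality
  relations from which the angles are solved.\<close>

lemma unitary_sem: "wf C \<Longrightarrow> unitary (ar C) (sem C)"
proof (induction C)
  case (Ph x)
  show ?case
    by (auto simp: unitary_def scalar_prod_def cis_cnj cis_mult intro!: eq_matI)
next
  case (Bs x)
  show ?case
    unfolding unitary_def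
    by (intro conjI mult_eqI2)
      (use cos_sin_mult_self[of x] in \<open>simp_all add: algebra_simps\<close>)
next
  case Sw
  show ?case
    unfolding unitary_def by (intro conjI mult_eqI2) simp_all
next
  case (Seq C2 C1)
  then show ?case by (simp add: unitary_mult)
next
  case (Par C1 C2)
  then show ?case by (simp add: unitary_dsum)
qed (simp_all add: unitary_def)

lemma sem_carrier: "wf C \<Longrightarrow> sem C \<in> carrier_mat (ar C) (ar C)"
  using unitary_sem unitary_carrier by blast

lemma sem_dim: "wf C \<Longrightarrow> dim_row (sem C) = ar C" "wf C \<Longrightarrow> dim_col (sem C) = ar C"
  using sem_carrier by auto

section \<open>Identities, wire permutations and soundness\<close>

lemma wf_idk [simp]: "wf (idk n)" and ar_idk [simp]: "ar (idk n) = n"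
  and sem_idk [simp]: "sem (idk n) = 1\<^sub>m n"
  by (induction n) auto

lemma wf_sigma [simp]: "wf (sigma n)" and ar_sigma [simp]: "ar (sigma n) = Suc n"
proof -
  have "wf (sigma n) \<and> ar (sigma n) = Suc n" by (induction n) auto
  then show "wf (sigma n)" "ar (sigma n) = Suc n" by auto
qed

text \<open>The 1 of row \<open>i\<close> stands in column \<open>p i\<close>: a product with this
  matrix on the left reads row \<open>p i\<close>, and one on the right reads the column that
  \<open>p\<close> sends to the given one.\<close>

definition perm_mat :: "nat \<Rightarrow> (nat \<Rightarrow> nat) \<Rightarrow> complex mat" where
  "perm_mat n p = mat n n (\<lambda>(i, j). if j = p i then 1 else 0)"

lemma perm_mat_carrier [simp]: "perm_mat n p \<in> carrier_mat n n"
  by (simp add: perm_mat_def)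

lemma perm_mat_mult:
  assumes "M \<in> carrier_mat n m" "p i < n" "i < n" "j < m"
  shows "(perm_mat n p * M) $$ (i, j) = M $$ (p i, j)"
proof -
  have "row (perm_mat n p) i = unit_vec n (p i)"
    using assms(3) by (intro eq_vecI) (auto simp: perm_mat_def unit_vec_def)
  then show ?thesis
    using assms by (simp add: perm_mat_def scalar_prod_left_unit[where n = n])
qed

lemma mult_perm_mat:
  assumes "M \<in> carrier_mat m n" "\<And>i. i < n \<Longrightarrow> j = p i \<longleftrightarrow> i = q" "q < n" "i < m" "j < n"
  shows "(M * perm_mat n p) $$ (i, j) = M $$ (i, q)"
proof -
  have "col (perm_mat n p) j = unit_vec n q"
    using assms(2,5) by (intro eq_vecI) (auto simp: perm_mat_def unit_vec_def)
  then show ?thesis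
    using assms(1,3-5) by (simp add: perm_mat_def scalar_prod_right_unit[where n = n])
qed

text \<open>The last wire moves to the top and all others move down by one. In the induction, the
  inner \<open>sigma k\<close> brings the last wire to the second place and the swap lifts it to the
  top.\<close>

lemma sem_sigma: "sem (sigma k) = perm_mat (Suc k) (\<lambda>i. if i = 0 then k else i - 1)"
proof (induction k)
  case 0
  show ?case by (rule eq_matI) (auto simp: perm_mat_def)
next
  case (Suc k)
  let ?s = "\<lambda>i::nat. if i = 0 then 1 else if i = 1 then 0 else i"
  have s: "dsum (sem Sw) (1\<^sub>m k) = perm_mat (Suc (Suc k)) ?s"
    by (rule eq_matI) (auto simp: dsum_index perm_mat_def less_Suc_eq numeral_2_eq_2)
  have "perm_mat (Suc (Suc k)) ?s * dsum (1\<^sub>m 1) (sem (sigma k))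
      = perm_mat (Suc (Suc k)) (\<lambda>i. if i = 0 then Suc k else i - 1)" (is "?L = ?R")
  proof (rule eq_matI)
    fix i j assume "i < dim_row ?R" "j < dim_col ?R"
    then have ij: "i < Suc (Suc k)" "j < Suc (Suc k)" by (auto simp: perm_mat_def)
    have c: "dsum (1\<^sub>m 1) (sem (sigma k)) \<in> carrier_mat (Suc (Suc k)) (Suc (Suc k))"
      using dsum_carrier[of "1\<^sub>m 1" 1 "sem (sigma k)" "Suc k"] Suc by simp
    have "?L $$ (i, j) = dsum (1\<^sub>m 1) (sem (sigma k)) $$ (?s i, j)"
      using ij by (intro perm_mat_mult[OF c]) auto
    also have "\<dots> = ?R $$ (i, j)"
      using ij unfolding Suc by (auto simp: perm_mat_def dsum_index)
    finally show "?L $$ (i, j) = ?R $$ (i, j)" .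
  qed (auto simp: perm_mat_def Suc)
  then show ?case
    by (simp only: sem_Par sem.simps(3,6) sigma.simps sem_idk s)
qed

lemma sem_sigma_natural:
  assumes "wf C"
  shows "sem (sigma (ar C)) * dsum (sem C) (1\<^sub>m 1) = dsum (1\<^sub>m 1) (sem C) * sem (sigma (ar C))"
    (is "?L = ?R")
proof (rule eq_matI)
  let ?k = "ar C"
  let ?p = "\<lambda>i. if i = 0 then ?k else i - 1"
  have c: "sem C \<in> carrier_mat ?k ?k" using assms by (rule sem_carrier)
  fix i j assume "i < dim_row ?R" "j < dim_col ?R"
  then have ij: "i < Suc ?k" "j < Suc ?k" using c by (auto simp: sem_sigma perm_mat_def)
  have "?L $$ (i, j) = dsum (sem C) (1\<^sub>m 1) $$ (?p i, j)"
    unfolding sem_sigma using ij dsum_carrier[OF c, of "1\<^sub>m 1" 1]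
    by (intro perm_mat_mult) auto
  \<comment> \<open>The column \<open>if j = ?k then 0 else Suc j\<close> is the preimage of
    \<open>j\<close> under \<open>?p\<close>, in the form that \<open>mult_perm_mat\<close>
    expects.\<close>
  also have "\<dots> = dsum (1\<^sub>m 1) (sem C) $$ (i, if j = ?k then 0 else Suc j)"
    using ij c by (auto simp: dsum_index)
  also have "\<dots> = ?R $$ (i, j)"
    unfolding sem_sigma using ij dsum_carrier[OF _ c, of "1\<^sub>m 1" 1]
    by (intro mult_perm_mat[symmetric]) auto
  finally show "?L $$ (i, j) = ?R $$ (i, j)" .
qed (use assms in \<open>auto simp: sem_sigma perm_mat_def sem_dim\<close>)

lemma lopp_wf: "lopp C1 C2 \<Longrightarrow> wf C1 \<and> wf C2 \<and> ar C1 = ar C2"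
  by (induction rule: lopp.induct)
     (auto simp: F_lhs_def F_rhs_def G_lhs_def G_rhs_def B01_def B12_def Phi0_def Phi1_def Phi2_def)

lemma sem_assoc:
  "wf A \<Longrightarrow> wf B \<Longrightarrow> wf C \<Longrightarrow> ar A = ar B \<Longrightarrow> ar B = ar C \<Longrightarrow>
    (sem A * sem B) * sem C = sem A * (sem B * sem C)"
  by (metis assoc_mult_mat sem_carrier)

lemma lopp_sound: "lopp C1 C2 \<Longrightarrow> sem C1 = sem C2"
proof (induction rule: lopp.induct)
  case (id_left C k)
  then show ?case by (auto simp: left_mult_one_mat[OF sem_carrier])
next
  case (id_right C k)
  then show ?case by (auto simp: right_mult_one_mat[OF sem_carrier])
next
  case (seq_assoc C3 C2 C1)
  then show ?case by (simp add: sem_assoc)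
next
  case (interchange C2 C1 C4 C3)
  then show ?case
    using dsum_mult[of "sem C2" "ar C1" "sem C1" "sem C4" "ar C3" "sem C3"]
      sem_carrier[of C1] sem_carrier[of C2] sem_carrier[of C3] sem_carrier[of C4] by simp
next
  case (sigma_nat C k)
  then show ?case using sem_sigma_natural by auto
next
  case sw_sw
  have "sem Sw * sem Sw = 1\<^sub>m 2"
    by (rule mult_eqI2) simp_all
  then show ?case by (simp add: numeral_2_eq_2)
next
  case ax_C
  have "diag2 (cis (- pi / 2)) (cis (- pi / 2)) * sem (Bs (pi / 2)) = sem Sw"
    by (rule mult_eqI2) (simp_all add: diag2_index complex_eq_iff)
  then show ?case
    by (simp only: sem_Par sem.simps(6) dsum_Ph_Ph)
next
  case (ax_D p2 p1)
  show ?case by (auto simp: scalar_prod_def cis_mult add.commute intro!: eq_matI)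
next
  case (ax_E t p)
  let ?d = "diag2 (cis p) (cis p)"
  have "sem (Bs t) * ?d = ?d * sem (Bs t)"
  proof (rule mult_eqI2)
    show "?d * sem (Bs t) \<in> carrier_mat 2 2" by (rule mult_carrier_mat[OF diag2_carrier sem_Bs_carrier])
  qed (simp_all only: mult_index2[OF diag2_carrier sem_Bs_carrier] pos2 one_less_numeral_iff semiring_norm,
      simp_all add: diag2_index)
  then show ?case
    by (simp only: sem_Par sem.simps(6) dsum_Ph_Ph)
next
  case ax_A0
  show ?case by (rule eq_matI) auto
next
  case ax_A2pi
  show ?case by (rule eq_matI) auto
next
  case ax_B
  show ?case by (rule eq_matI) (auto simp: dsum_index)
next
  case (par_assoc C1 C2 C3)
  show ?case by (simp add: dsum_assoc)
qed (simp_all add: F_cond_def G_cond_def)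

section \<open>Solvability of the angle constraints of axioms (F) and (G)\<close>

lemma cmod_eq_1_if_square: "(cmod z)\<^sup>2 = 1 \<Longrightarrow> cmod z = 1"
  by (metis abs_norm_cancel abs_square_eq_1)

lemma unit_complex_cis:
  assumes "cmod z = 1"
  obtains c where "0 \<le> c" "c < 2 * pi" "z = cis c"
proof -
  have "(Re z)\<^sup>2 + (Im z)\<^sup>2 = 1"
    using assms by (metis cmod_power2 one_power2)
  then obtain c where "0 \<le> c" "c < 2 * pi" "Re z = cos c" "Im z = sin c"
    by (rule sincos_total_2pi)
  then show ?thesis
    using that by (simp add: complex_eq_iff)
qed

text \<open>A real factor of either sign absorbs a half turn, which brings the angle below
  \<open>pi\<close>.\<close>

lemma complex_cis_half_turn:
  assumes "z \<noteq> 0"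
  obtains a r where "0 \<le> a" "a < pi" "z = of_real r * cis a" "r \<noteq> 0"
proof -
  have "cmod (z / of_real (cmod z)) = 1"
    using assms by (simp add: norm_divide)
  then obtain c where c: "0 \<le> c" "c < 2 * pi" "z / of_real (cmod z) = cis c"
    by (rule unit_complex_cis)
  then have z: "z = of_real (cmod z) * cis c"
    using assms by (simp add: field_simps)
  show ?thesis
  proof (cases "c < pi")
    case True
    then show ?thesis using that[of c "cmod z"] c z assms by simp
  next
    case False
    have "cis c = - cis (c - pi)"
      by (simp add: complex_eq_iff cos_diff sin_diff)
    then show ?thesis
      using False that[of "c - pi" "- cmod z"] c z assms by simp
  qed
qed

text \<open>Up to the common phase \<open>c\<close>, the right-hand sides are the first row of
  \<open>Bs b\<close> preceded by the phase \<open>a\<close> on the upper mode. Rows with a zero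
  entry are treated apart, since the side condition then fixes \<open>a\<close>.\<close>

lemma unit_row_angles:
  fixes u v :: complex
  assumes "(cmod u)\<^sup>2 + (cmod v)\<^sup>2 = 1"
  obtains a b c where "0 \<le> a" "a < pi" "0 \<le> b" "b < pi" "0 \<le> c" "c < 2 * pi"
    "b \<in> {0, pi / 2} \<longrightarrow> a = 0"
    "u = cis c * (of_real (cos b) * cis a)" "v = cis c * (\<i> * of_real (sin b))"
proof (cases "v = 0")
  case True
  then have "cmod u = 1"
    using assms by (simp add: cmod_eq_1_if_square)
  then obtain c where "0 \<le> c" "c < 2 * pi" "u = cis c"
    by (rule unit_complex_cis)
  then show ?thesis
    using True by (intro that[of 0 0 c]) auto
next
  case v: False
  show ?thesis
  proof (cases "u = 0")
    case True
    \<comment> \<open>Here \<open>b\<close> must be \<open>pi / 2\<close> and hence \<open>a\<close>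
      is 0; the whole phase of \<open>v\<close>, apart from the factor \<open>\<i>\<close>, goes
      into \<open>c\<close>.\<close>
    then have "cmod (- \<i> * v) = 1"
      using assms by (simp add: cmod_eq_1_if_square norm_mult)
    then obtain c where c: "0 \<le> c" "c < 2 * pi" "- \<i> * v = cis c"
      by (rule unit_complex_cis)
    have "v = \<i> * (- \<i> * v)" by simp
    then have "v = cis c * (\<i> * of_real (sin (pi / 2)))"
      unfolding c(3) by simp
    then show ?thesis
      using True c(1,2) by (intro that[of 0 "pi / 2" c]) auto
  next
    case False
    \<comment> \<open>In a solution this quotient is the cotangent of \<open>b\<close> times
      \<open>cis a\<close>: it does not involve \<open>c\<close>, and its argument modulo a half
      turn is \<open>a\<close>.\<close>
    then have "\<i> * u / v \<noteq> 0" using v by simp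
    then obtain a r where a: "0 \<le> a" "a < pi" "\<i> * u / v = of_real r * cis a" "r \<noteq> 0"
      by (rule complex_cis_half_turn)
    have u: "u = - \<i> * v * of_real r * cis a"
    proof -
      have "\<i> * u = v * (of_real r * cis a)"
        using a(3) v by (metis nonzero_mult_div_cancel_left times_divide_eq_right)
      then have "- \<i> * (\<i> * u) = - \<i> * (v * (of_real r * cis a))" by simp
      then show ?thesis by (simp add: mult.assoc)
    qed
    then have "cmod u = cmod v * \<bar>r\<bar>"
      by (simp add: norm_mult)
    then have "(r * cmod v)\<^sup>2 + (cmod v)\<^sup>2 = 1"
      using assms by (simp add: power_mult_distrib mult.commute)
    moreover have "0 \<le> cmod v" by simp
    ultimately obtain b where b: "0 \<le> b" "b \<le> pi" "r * cmod v = cos b" "cmod v = sin b"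
      using sincos_total_pi[of "cmod v" "r * cmod v"] by auto
    have sb: "sin b \<noteq> 0" using b(4) v by auto
    have cb: "cos b \<noteq> 0" using b(3) v a(4) by auto
    have "b \<noteq> 0" "b \<noteq> pi"
      using sb by auto
    moreover have "b \<noteq> pi / 2"
      using cb by (intro notI) (simp only: cos_pi_half simp_thms)
    ultimately have nb: "b \<noteq> 0" "b \<noteq> pi" "b \<noteq> pi / 2" by simp_all
    have "cmod (- \<i> * v / of_real (sin b)) = 1"
    proof -
      have "sin b > 0" using b(4) v by (metis zero_less_norm_iff)
      then show ?thesis by (simp add: norm_mult norm_divide b(4))
    qed
    then obtain c where c: "0 \<le> c" "c < 2 * pi" "- \<i> * v / of_real (sin b) = cis c"
      by (rule unit_complex_cis)
    have iv: "- \<i> * v = cis c * of_real (sin b)"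
      using c(3) sb by (simp add: field_simps)
    then have "\<i> * (- \<i> * v) = \<i> * (cis c * of_real (sin b))" by simp
    then have v': "v = cis c * (\<i> * of_real (sin b))" by (simp add: mult_ac)
    have "u = cis c * (of_real (sin b) * of_real r * cis a)"
      using u unfolding iv by (simp add: mult_ac)
    also have "of_real (sin b) * of_real r = (of_real (cos b) :: complex)"
      using b(3,4) by (metis mult.commute of_real_mult)
    finally show ?thesis
      using v' a c b nb by (intro that[of a b c]) auto
  qed
qed

lemma carrier_mult2 [simp]:
  "A \<in> carrier_mat 2 2 \<Longrightarrow> B \<in> carrier_mat 2 2 \<Longrightarrow> A * B \<in> carrier_mat 2 2"
  by (rule mult_carrier_mat)

lemma carrier_mult3 [simp]:
  "A \<in> carrier_mat 3 3 \<Longrightarrow> B \<in> carrier_mat 3 3 \<Longrightarrow> A * B \<in> carrier_mat 3 3"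
  by (rule mult_carrier_mat)

lemma diag2_mult: "diag2 a b * diag2 c d = diag2 (a * c) (b * d)"
  by (rule mult_eqI2) (simp_all add: diag2_index)

lemma dsum_Ph_Idw: "dsum (sem (Ph a)) (1\<^sub>m 1) = diag2 (cis a) 1"
  by (rule eq_matI) (auto simp: dsum_index diag2_index diag2_def)

lemma dsum_Idw_Ph: "dsum (1\<^sub>m 1) (sem (Ph a)) = diag2 1 (cis a)"
  by (rule eq_matI) (auto simp: dsum_index diag2_index diag2_def)

lemma unitary2_rows:
  assumes "unitary 2 V" "i < 2" "j < 2"
  shows "V $$ (i, 0) * cnj (V $$ (j, 0)) + V $$ (i, 1) * cnj (V $$ (j, 1)) = (if i = j then 1 else 0)"
proof -
  have c: "V \<in> carrier_mat 2 2" and e: "V * adj V = 1\<^sub>m 2"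
    using assms by (auto simp: unitary_def)
  have "(V * adj V) $$ (i, j) = (if i = j then 1 else 0)"
    unfolding e using assms by simp
  then show ?thesis
    unfolding mult_index2[OF c adj_carrier[OF c] assms(2,3)] using c assms by simp
qed

lemma cmod_squares_one:
  "u * cnj u + v * cnj v = 1 \<Longrightarrow> (cmod u)\<^sup>2 + (cmod v)\<^sup>2 = 1"
  by (metis complex_norm_square of_real_add of_real_eq_1_iff)

text \<open>The first row yields \<open>b1\<close>, \<open>b2\<close> and \<open>b3\<close> by
  \<open>unit_row_angles\<close>. The second row is orthogonal to it and has norm 1, which leaves
  only a phase, namely \<open>b4\<close>.\<close>

lemma unitary2_angles:
  assumes V: "unitary 2 V"
  obtains b1 b2 b3 b4 where "\<forall>b\<in>{b1, b2, b3, b4}. 0 \<le> b \<and> b < 2 * pi"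
    "b1 < pi" "b2 < pi" "b2 \<in> {0, pi / 2} \<longrightarrow> b1 = 0"
    "V = diag2 (cis b3) (cis b4) * (sem (Bs b2) * diag2 (cis b1) 1)"
proof -
  define u v p q where "u = V $$ (0, 0)" "v = V $$ (0, 1)" "p = V $$ (1, 0)" "q = V $$ (1, 1)"
  note defs = this
  have uv: "u * cnj u + v * cnj v = 1" and pq: "p * cnj p + q * cnj q = 1"
    and ortho: "p * cnj u + q * cnj v = 0"
    using unitary2_rows[OF V, of 0 0] unitary2_rows[OF V, of 1 1] unitary2_rows[OF V, of 1 0]
    by (simp_all add: defs)
  obtain a b c where abc: "0 \<le> a" "a < pi" "0 \<le> b" "b < pi" "0 \<le> c" "c < 2 * pi"
    "b \<in> {0, pi / 2} \<longrightarrow> a = 0"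
    and u: "u = cis c * (of_real (cos b) * cis a)" and v: "v = cis c * (\<i> * of_real (sin b))"
    using unit_row_angles[OF cmod_squares_one[OF uv]] by metis
  define C S e e' f :: complex where
    "C = of_real (cos b)" "S = of_real (sin b)" "e = cis a" "e' = cis (- a)" "f = cis (- c)"
  note defs2 = this
  have CS: "C * C + S * S = 1" unfolding defs2 by (rule cos_sin_mult_self)
  have ee: "e * e' = 1" by (simp add: defs2 cis_mult)
  have "cis c * f = 1" by (simp add: defs2 cis_mult)
  have cnjs: "cnj u = f * (C * e')" "cnj v = - f * (\<i> * S)" "cnj C = C" "cnj S = S" "cnj e = e'"
    by (simp_all add: u v defs2 cis_cnj)
  have "f * (p * C * e' - q * \<i> * S) = 0"
    using ortho unfolding cnjs by (simp add: algebra_simps)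
  then have o: "p * C * e' = q * \<i> * S"
    using \<open>cis c * f = 1\<close> by auto
  \<comment> \<open>The inner product of the second row with the unit vector
    \<open>(\<i> * S * e, C)\<close>, which spans the orthogonal complement of the first
    row.\<close>
  define s where "s = q * C - p * \<i> * S * e'"
  have p: "p = s * (\<i> * S * e)"
  proof -
    have "s * (\<i> * S * e) = C * e * (q * \<i> * S) + p * (S * S) * (e * e')"
      by (simp add: s_def algebra_simps)
    also have "\<dots> = p * (C * C + S * S) * (e * e')"
      unfolding o[symmetric] by (simp add: algebra_simps)
    finally show ?thesis using CS ee by simp
  qed
  have q: "q = s * C"
  proof -
    have "s * C = q * (C * C) - \<i> * S * (p * C * e')"
      by (simp add: s_def algebra_simps)
    also have "\<dots> = q * (C * C + S * S)"
      unfolding o by (simp add: algebra_simps)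
    finally show ?thesis using CS by simp
  qed
  have "p * cnj p + q * cnj q = s * cnj s * (C * C + S * S * (e * e'))"
    unfolding p q by (simp add: cnjs algebra_simps)
  then have "s * cnj s = 1"
    using pq CS ee by simp
  then have "cmod s = 1"
    using cmod_squares_one[of s 0] by (simp add: cmod_eq_1_if_square)
  then obtain d where d: "0 \<le> d" "d < 2 * pi" "s = cis d"
    by (rule unit_complex_cis)
  have "diag2 (cis c) (cis d) * (sem (Bs b) * diag2 (cis a) 1) = V"
  proof (rule mult_eqI2)
    show "sem (Bs b) * diag2 (cis a) 1 \<in> carrier_mat 2 2"
      by (rule carrier_mult2[OF sem_Bs_carrier diag2_carrier])
    show "V \<in> carrier_mat 2 2" using V by (rule unitary_carrier)
  qed (simp_all only: mult_index2[OF sem_Bs_carrier diag2_carrier] sem_Bs_index diag2_index pos2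
        one_less_numeral_iff semiring_norm,
      use u v p q d(3) in \<open>simp_all add: defs2 flip: defs[unfolded One_nat_def]\<close>)
  then show ?thesis
    using abc d(1,2) by (intro that[of a b c d]) auto
qed

lemma F_angles_exist: "\<exists>b1 b2 b3 b4. F_cond a1 a2 a3 b1 b2 b3 b4"
proof -
  have "unitary 2 (sem (F_lhs a1 a2 a3))"
    using unitary_sem[of "F_lhs a1 a2 a3"] by (simp add: F_lhs_def)
  then obtain b1 b2 b3 b4 where b: "\<forall>b\<in>{b1, b2, b3, b4}. 0 \<le> b \<and> b < 2 * pi"
    "b1 < pi" "b2 < pi" "b2 \<in> {0, pi / 2} \<longrightarrow> b1 = 0"
    and V: "sem (F_lhs a1 a2 a3) = diag2 (cis b3) (cis b4) * (sem (Bs b2) * diag2 (cis b1) 1)"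
    by (rule unitary2_angles)
  have "sem (F_lhs a1 a2 a3) = sem (F_rhs b1 b2 b3 b4)"
    unfolding V F_rhs_def sem_Par sem.simps(6) sem.simps(3) dsum_Ph_Ph dsum_Ph_Idw ..
  then show ?thesis
    using b unfolding F_cond_def by blast
qed

lemma dsum_right_inject:
  assumes "dsum A B = dsum A B'" "dim_row B = dim_row B'" "dim_col B = dim_col B'"
  shows "B = B'"
proof (rule eq_matI)
  fix i j assume "i < dim_row B'" "j < dim_col B'"
  then show "B $$ (i, j) = B' $$ (i, j)"
    using arg_cong[OF assms(1), of "\<lambda>M. M $$ (dim_row A + i, dim_col A + j)"] assms(2,3)
    by (simp add: dsum_index)
qed (use assms in auto)

text \<open>The columns of a unitary matrix also have norm 1, and the corner entry already accounts
  for all of it.\<close>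

lemma unitary_first_column:
  assumes "unitary n W" "0 < n" "cmod (W $$ (0, 0)) = 1" "0 < i" "i < n"
  shows "W $$ (i, 0) = 0"
proof -
  have c: "W \<in> carrier_mat n n" using assms(1) by (rule unitary_carrier)
  have "(adj W * W) $$ (0, 0) = 1"
    using unitary_adj_mult[OF assms(1)] assms(2) by simp
  then have "(\<Sum>k<n. cnj (W $$ (k, 0)) * W $$ (k, 0)) = 1"
    using c assms(2) by (simp add: scalar_prod_def lessThan_atLeast0)
  then have "(\<Sum>k<n. complex_of_real ((cmod (W $$ (k, 0)))\<^sup>2)) = 1"
    by (simp only: complex_norm_square mult.commute)
  then have "(\<Sum>k<n. (cmod (W $$ (k, 0)))\<^sup>2) = 1"
    by (metis of_real_eq_1_iff of_real_sum)
  moreover have "(\<Sum>k\<in>{0, i}. (cmod (W $$ (k, 0)))\<^sup>2) \<le> (\<Sum>k<n. (cmod (W $$ (k, 0)))\<^sup>2)"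
    using assms by (intro sum_mono2) auto
  ultimately have "(cmod (W $$ (i, 0)))\<^sup>2 \<le> 0"
    using assms by simp
  then show ?thesis by simp
qed

text \<open>The rest of the first row vanishes by assumption and the rest of the first column by
  \<open>unitary_first_column\<close>; unitarity of \<open>W\<close> then passes to its lower
  block.\<close>

lemma unitary3_split:
  assumes W: "unitary 3 W" and r: "W $$ (0, 0) = cis c" "W $$ (0, 1) = 0" "W $$ (0, 2) = 0"
  obtains V where "unitary 2 V" "W = dsum (sem (Ph c)) V"
proof -
  define V where "V = mat 2 2 (\<lambda>(i, j). W $$ (Suc i, Suc j))"
  have V: "V \<in> carrier_mat 2 2" by (simp add: V_def)
  have Wc: "W \<in> carrier_mat 3 3" using W by (rule unitary_carrier)
  have col: "W $$ (i, 0) = 0" if "0 < i" "i < 3" for i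
    using unitary_first_column[OF W] r(1) that by simp
  have row: "W $$ (0, j) = 0" if "0 < j" "j < 3" for j
    using r that by (auto simp: numeral_3_eq_3 numeral_2_eq_2 less_Suc_eq)
  have eq: "W = dsum (sem (Ph c)) V" (is "_ = ?R")
  proof (rule eq_matI)
    fix i j assume "i < dim_row ?R" "j < dim_col ?R"
    then have ij: "i < 3" "j < 3" using V by auto
    then show "W $$ (i, j) = ?R $$ (i, j)"
      using V r(1) row[of j] col[of i] by (auto simp: dsum_index V_def)
  qed (use Wc V in auto)
  have "dsum (1\<^sub>m 1) (V * adj V) = dsum (1\<^sub>m 1) (1\<^sub>m 2)"
  proof -
    have P: "sem (Ph c) * adj (sem (Ph c)) = 1\<^sub>m 1"
      using unitary_sem[of "Ph c"] by (simp only: unitary_def wf.simps ar.simps)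
    have "dsum (sem (Ph c) * adj (sem (Ph c))) (V * adj V) = W * adj W"
      unfolding eq dsum_adj
      by (rule dsum_mult[symmetric]) (use V in auto)
    also have "\<dots> = dsum (1\<^sub>m 1) (1\<^sub>m 2)"
      using W by (simp add: unitary_def numeral_3_eq_3)
    finally show ?thesis unfolding P .
  qed
  then have "V * adj V = 1\<^sub>m 2"
    by (rule dsum_right_inject) (use V in auto)
  then have "unitary 2 V" using V by (simp add: unitary_def)
  then show ?thesis using eq that by blast
qed

section \<open>Three-mode unitaries and the angles of axiom (G)\<close>

lemma three_mode_carriers [simp]:
  "sem (B01 t) \<in> carrier_mat 3 3" "sem (B12 t) \<in> carrier_mat 3 3"
  "sem (Phi0 t) \<in> carrier_mat 3 3" "sem (Phi1 t) \<in> carrier_mat 3 3" "sem (Phi2 t) \<in> carrier_mat 3 3"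
  using sem_carrier[of "B01 t"] sem_carrier[of "B12 t"] sem_carrier[of "Phi0 t"]
    sem_carrier[of "Phi1 t"] sem_carrier[of "Phi2 t"]
  by (simp_all add: B01_def B12_def Phi0_def Phi1_def Phi2_def numeral_3_eq_3
      del: sem.simps sem_Par)

lemma three_mode_blocks:
  "sem (B12 t) = dsum (1\<^sub>m 1) (sem (Bs t))"
  "sem (Phi0 t) = dsum (sem (Ph t)) (1\<^sub>m 2)"
  "sem (Phi1 t) = dsum (1\<^sub>m 1) (diag2 (cis t) 1)"
  "sem (Phi2 t) = dsum (1\<^sub>m 1) (diag2 1 (cis t))"
  unfolding B12_def Phi0_def Phi1_def Phi2_def sem_Par
  by (simp_all only: sem.simps(3) dsum_Ph_Idw dsum_Idw_Ph dsum_one one_add_one)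

lemma B01_index:
  "i < 3 \<Longrightarrow> j < 3 \<Longrightarrow> sem (B01 t) $$ (i, j) =
    (if i < 2 \<and> j < 2 then if i = j then of_real (cos t) else \<i> * of_real (sin t)
     else if i = j then 1 else 0)"
  by (auto simp: B01_def dsum_index)

lemma B12_index:
  "i < 3 \<Longrightarrow> j < 3 \<Longrightarrow> sem (B12 t) $$ (i, j) =
    (if 0 < i \<and> 0 < j then if i = j then of_real (cos t) else \<i> * of_real (sin t)
     else if i = j then 1 else 0)"
  by (auto simp: B12_def dsum_index)

lemma Phi0_index: "i < 3 \<Longrightarrow> j < 3 \<Longrightarrow> sem (Phi0 t) $$ (i, j) =
    (if i = j then if i = 0 then cis t else 1 else 0)"
  by (auto simp: Phi0_def dsum_index)

lemma Phi1_index: "i < 3 \<Longrightarrow> j < 3 \<Longrightarrow> sem (Phi1 t) $$ (i, j) =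
    (if i = j then if i = 1 then cis t else 1 else 0)"
  by (auto simp: Phi1_def dsum_index)

text \<open>The gates of \<open>G_rhs\<close> with angles 1 to 4. The later gates touch mode 0 only
  by a phase, so the first row of \<open>G_rhs\<close> is a phase times the first row of this
  circuit.\<close>

definition K_circ :: "real \<Rightarrow> real \<Rightarrow> real \<Rightarrow> real \<Rightarrow> circ" where
  "K_circ d1 d2 d3 d4 = Seq (B01 d4) (Seq (B12 d3) (Seq (Phi0 d2) (Phi1 d1)))"

lemma unitary_K: "unitary 3 (sem (K_circ d1 d2 d3 d4))"
  using unitary_sem[of "K_circ d1 d2 d3 d4"]
  by (simp add: K_circ_def B01_def B12_def Phi0_def Phi1_def numeral_3_eq_3 del: sem.simps sem_Par)

lemma K_row:
  "sem (K_circ d1 d2 d3 d4) $$ (0, 0) = of_real (cos d4) * cis d2"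
  "sem (K_circ d1 d2 d3 d4) $$ (0, 1) = \<i> * of_real (sin d4) * of_real (cos d3) * cis d1"
  "sem (K_circ d1 d2 d3 d4) $$ (0, 2) = \<i> * of_real (sin d4) * (\<i> * of_real (sin d3))"
  unfolding K_circ_def sem.simps(6)
  by (simp_all add: mult_index3 B01_index B12_index Phi0_index Phi1_index del: index_mult_mat)

text \<open>Two uses of \<open>unit_row_angles\<close>: the normalized pair \<open>(v, w)\<close>
  gives \<open>d1\<close> and \<open>d3\<close>, and \<open>u\<close> together with the length and
  phase of that pair gives \<open>d2\<close>, \<open>d4\<close> and \<open>c\<close>. If the pair
  vanishes, all angles but \<open>c\<close> are set to 0, as the constraint for
  \<open>d4 = 0\<close> requires.\<close>

lemma unit_row3_angles:
  assumes "(cmod u)\<^sup>2 + (cmod v)\<^sup>2 + (cmod w)\<^sup>2 = 1"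
  obtains d1 d2 d3 d4 c where
    "0 \<le> d1" "d1 < pi" "0 \<le> d2" "d2 < pi" "0 \<le> d3" "d3 < pi" "0 \<le> d4" "d4 < pi" "0 \<le> c" "c < 2 * pi"
    "d3 \<in> {0, pi / 2} \<longrightarrow> d1 = 0" "d4 \<in> {0, pi / 2} \<longrightarrow> d2 = 0" "d4 = 0 \<longrightarrow> d3 = 0"
    "u = cis c * (of_real (cos d4) * cis d2)"
    "v = cis c * (\<i> * of_real (sin d4) * of_real (cos d3) * cis d1)"
    "w = cis c * (\<i> * of_real (sin d4) * (\<i> * of_real (sin d3)))"
proof -
  define \<rho> where "\<rho> = sqrt ((cmod v)\<^sup>2 + (cmod w)\<^sup>2)"
  have \<rho>2: "\<rho>\<^sup>2 = (cmod v)\<^sup>2 + (cmod w)\<^sup>2"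
    by (simp add: \<rho>_def)
  show ?thesis
  proof (cases "\<rho> = 0")
    case True
    then have "v = 0" "w = 0" using \<rho>2 by (auto simp: sum_power2_eq_zero_iff)
    moreover from this have "cmod u = 1"
      using assms by (simp add: cmod_eq_1_if_square)
    then obtain c where "0 \<le> c" "c < 2 * pi" "u = cis c"
      by (rule unit_complex_cis)
    ultimately show ?thesis
      by (intro that[of 0 0 0 0 c]) auto
  next
    case False
    have "(cmod (v / of_real \<rho>))\<^sup>2 + (cmod (w / of_real \<rho>))\<^sup>2 = 1"
      using False by (simp add: norm_divide power_divide flip: add_divide_distrib \<rho>2)
    then obtain a b c where abc: "0 \<le> a" "a < pi" "0 \<le> b" "b < pi" "0 \<le> c" "c < 2 * pi"
      "b \<in> {0, pi / 2} \<longrightarrow> a = 0"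
      and v: "v / of_real \<rho> = cis c * (of_real (cos b) * cis a)"
      and w: "w / of_real \<rho> = cis c * (\<i> * of_real (sin b))"
      by (rule unit_row_angles)
    have "(cmod u)\<^sup>2 + (cmod (of_real \<rho> * cis c))\<^sup>2 = 1"
      using assms by (simp add: norm_mult \<rho>2)
    then obtain a' b' c' where abc': "0 \<le> a'" "a' < pi" "0 \<le> b'" "b' < pi" "0 \<le> c'" "c' < 2 * pi"
      "b' \<in> {0, pi / 2} \<longrightarrow> a' = 0"
      and u: "u = cis c' * (of_real (cos b') * cis a')"
      and rc: "of_real \<rho> * cis c = cis c' * (\<i> * of_real (sin b'))"
      by (rule unit_row_angles)
    have "b' \<noteq> 0" using rc False by auto
    have "v = (of_real \<rho> * cis c) * (of_real (cos b) * cis a)"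
      using v False by (simp add: field_simps)
    moreover have "w = (of_real \<rho> * cis c) * (\<i> * of_real (sin b))"
      using w False by (simp add: field_simps)
    ultimately show ?thesis
      unfolding rc using u abc abc' \<open>b' \<noteq> 0\<close> by (intro that[of a a' b b' c']) (auto simp: mult_ac)
  qed
qed

text \<open>With \<open>K\<close> chosen so that its first row matches that of \<open>U\<close> up
  to the phase \<open>c\<close>, the quotient \<open>U * adj K\<close> has first row
  \<open>(cis c, 0, 0)\<close>. It therefore splits into a phase and a two-mode unitary, which
  \<open>unitary2_angles\<close> resolves.\<close>

lemma G_angles_exist: "\<exists>d. G_cond g1 g2 g3 g4 d"
proof -
  define U where "U = sem (G_lhs g1 g2 g3 g4)"
  have U: "unitary 3 U"
    using unitary_sem[of "G_lhs g1 g2 g3 g4"] unfolding U_def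
    by (simp add: G_lhs_def B01_def B12_def Phi0_def numeral_3_eq_3 del: sem.simps sem_Par)
  then have Uc: "U \<in> carrier_mat 3 3" by (rule unitary_carrier)
  have "(U * adj U) $$ (0, 0) = 1"
    using U by (simp add: unitary_def)
  then have "U $$ (0, 0) * cnj (U $$ (0, 0)) + U $$ (0, 1) * cnj (U $$ (0, 1))
      + U $$ (0, 2) * cnj (U $$ (0, 2)) = 1"
    unfolding mult_index3[OF Uc adj_carrier[OF Uc] zero_less_numeral zero_less_numeral]
    using Uc by simp
  then have "(cmod (U $$ (0, 0)))\<^sup>2 + (cmod (U $$ (0, 1)))\<^sup>2 + (cmod (U $$ (0, 2)))\<^sup>2 = 1"
    by (metis complex_norm_square of_real_add of_real_eq_1_iff)
  then obtain d1 d2 d3 d4 c where d: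
    "0 \<le> d1" "d1 < pi" "0 \<le> d2" "d2 < pi" "0 \<le> d3" "d3 < pi" "0 \<le> d4" "d4 < pi" "0 \<le> c" "c < 2 * pi"
    "d3 \<in> {0, pi / 2} \<longrightarrow> d1 = 0" "d4 \<in> {0, pi / 2} \<longrightarrow> d2 = 0" "d4 = 0 \<longrightarrow> d3 = 0"
    and row: "U $$ (0, 0) = cis c * (of_real (cos d4) * cis d2)"
    "U $$ (0, 1) = cis c * (\<i> * of_real (sin d4) * of_real (cos d3) * cis d1)"
    "U $$ (0, 2) = cis c * (\<i> * of_real (sin d4) * (\<i> * of_real (sin d3)))"
    by (rule unit_row3_angles)
  define K where "K = sem (K_circ d1 d2 d3 d4)"
  have K: "unitary 3 K" unfolding K_def by (rule unitary_K)
  then have Kc: "K \<in> carrier_mat 3 3" by (rule unitary_carrier)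
  have rowK: "U $$ (0, 0) = cis c * K $$ (0, 0)" "U $$ (0, 1) = cis c * K $$ (0, 1)"
    "U $$ (0, 2) = cis c * K $$ (0, 2)"
    unfolding K_def by (simp_all only: K_row row)
  define W where "W = U * adj K"
  have W: "unitary 3 W" unfolding W_def by (intro unitary_mult U unitary_adj K)
  have Wr: "W $$ (0, j) = cis c * 1\<^sub>m 3 $$ (0, j)" if "j < 3" for j
  proof -
    have "W $$ (0, j) = cis c * (K * adj K) $$ (0, j)"
      unfolding W_def mult_index3[OF Uc adj_carrier[OF Kc] zero_less_numeral that]
        mult_index3[OF Kc adj_carrier[OF Kc] zero_less_numeral that] rowK
      by (simp add: algebra_simps)
    then show ?thesis using K by (simp add: unitary_def)
  qed
  have "W $$ (0, 0) = cis c" "W $$ (0, 1) = 0" "W $$ (0, 2) = 0"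
    using Wr[of 0] Wr[of 1] Wr[of 2] by simp_all
  then obtain V where V: "unitary 2 V" and WV: "W = dsum (sem (Ph c)) V"
    by (rule unitary3_split[OF W])
  obtain b1 b2 b3 b4 where b: "\<forall>b\<in>{b1, b2, b3, b4}. 0 \<le> b \<and> b < 2 * pi"
    "b1 < pi" "b2 < pi" "b2 \<in> {0, pi / 2} \<longrightarrow> b1 = 0"
    and V': "V = diag2 (cis b3) (cis b4) * (sem (Bs b2) * diag2 (cis b1) 1)"
    using unitary2_angles[OF V] by metis
  \<comment> \<open>Angles are numbered from 1, so the list entry at position 0 is a dummy.\<close>
  define d where "d = (\<lambda>i. [0, d1, d2, d3, d4, b1, b2, c, b3, b4] ! i)"
  have dv: "d 1 = d1" "d 2 = d2" "d 3 = d3" "d 4 = d4" "d 5 = b1" "d 6 = b2" "d 7 = c" "d 8 = b3" "d 9 = b4"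
    by (simp_all add: d_def)
  have Pc: "sem (Ph c) \<in> carrier_mat 1 1" by simp
  \<comment> \<open>All factors are block sums of sizes 1 and 2, so the product is computed in each
    block separately.\<close>
  have "sem (Phi2 b4) * (sem (Phi1 b3) * (sem (Phi0 c) * (sem (B12 b2) * sem (Phi1 b1)))) = W"
    unfolding WV V' three_mode_blocks
    by (simp only: dsum_mult[of _ 1 _ _ 2] Pc left_mult_one_mat[OF one_carrier_mat[of 1]]
        left_mult_one_mat[OF Pc] right_mult_one_mat[OF Pc]
        left_mult_one_mat[of _ 2 2] assoc_mult_mat[of _ 2 2 _ 2 _ 2, symmetric] diag2_mult
        one_carrier_mat diag2_carrier sem_Bs_carrier carrier_mult2 mult_1_left mult_1_right)
  then have "W * K = sem (G_rhs d)"
    using Kc unfolding G_rhs_def dv sem.simps(6) K_def K_circ_def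
    by (simp add: assoc_mult_mat[of _ 3 3 _ 3 _ 3] flip: \<open>_ = W\<close>)
  moreover have "W * K = U"
  proof -
    have "W * K = U * (adj K * K)"
      unfolding W_def by (rule assoc_mult_mat[of _ 3 3 _ 3 _ 3]) (use Uc Kc in auto)
    then show ?thesis using unitary_adj_mult[OF K] Uc by simp
  qed
  ultimately have "sem (G_lhs g1 g2 g3 g4) = sem (G_rhs d)"
    by (simp add: U_def)
  moreover have "\<forall>i\<in>{1..9}. 0 \<le> d i \<and> d i < 2 * pi" "\<forall>i\<in>{1..6}. d i < pi"
  proof -
    have "{1..9} = {1, 2, 3, 4, 5, 6, 7, 8, 9::nat}" "{1..6} = {1, 2, 3, 4, 5, 6::nat}" by auto
    then show "\<forall>i\<in>{1..9}. 0 \<le> d i \<and> d i < 2 * pi" "\<forall>i\<in>{1..6}. d i < pi"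
      using d(1-10) b(1-3) dv by auto
  qed
  ultimately show ?thesis
    using d(11-13) b(4) unfolding G_cond_def by (intro exI[of _ d]) (simp only: dv)
qed

section \<open>The monoidal category of circuits modulo the axioms\<close>

lemma lopp_part_equivp: "part_equivp lopp"
proof (rule part_equivpI)
  show "\<exists>x. lopp x x" using lopp.refl[of E] by auto
  show "symp lopp" by (rule sympI) (rule lopp.sym)
  show "transp lopp" by (rule transpI) (rule lopp.trans)
qed

\<comment> \<open>Only well-formed circuits are related to themselves, hence a partial quotient.
  Derivability becomes equality, and the proof can rewrite with equations.\<close>
quotient_type qcirc = circ / partial: lopp
  by (rule lopp_part_equivp)

lemma lopp_self_iff: "lopp x x \<longleftrightarrow> wf x"
  using lopp_wf lopp.refl by blast

lift_definition qar :: "qcirc \<Rightarrow> nat" is ar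
  using lopp_wf by blast

lift_definition qsem :: "qcirc \<Rightarrow> complex mat" is sem
  by (rule lopp_sound)

text \<open>Composition is made total by sending ill-typed composites to the empty circuit.\<close>

lift_definition qseq :: "qcirc \<Rightarrow> qcirc \<Rightarrow> qcirc" (infixr "\<diamond>" 70)
  is "\<lambda>C2 C1. if ar C1 = ar C2 then Seq C2 C1 else E"
proof -
  fix C2 C2' C1 C1' assume "lopp C2 C2'" "lopp C1 C1'"
  then show "lopp (if ar C1 = ar C2 then Seq C2 C1 else E) (if ar C1' = ar C2' then Seq C2' C1' else E)"
    using lopp_wf[of C1 C1'] lopp_wf[of C2 C2'] by (simp add: lopp.cong_seq lopp.refl)
qed

lift_definition qpar :: "qcirc \<Rightarrow> qcirc \<Rightarrow> qcirc" (infixr "\<parallel>" 75) is Par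
  by (rule lopp.cong_par)

lift_definition qph :: "real \<Rightarrow> qcirc" is Ph by (simp add: lopp.refl)
lift_definition qbs :: "real \<Rightarrow> qcirc" is Bs by (simp add: lopp.refl)
lift_definition qid :: "nat \<Rightarrow> qcirc" is idk by (simp add: lopp.refl)

definition cls :: "circ \<Rightarrow> qcirc" where "cls = abs_qcirc"

lemma cls_eq_iff: "wf C1 \<Longrightarrow> wf C2 \<Longrightarrow> cls C1 = cls C2 \<longleftrightarrow> lopp C1 C2"
  unfolding cls_def
  using Quotient3_rel[OF Quotient3_qcirc, of C1 C2] lopp_self_iff by blast

lemma qsem_cls: "wf C \<Longrightarrow> qsem (cls C) = sem C"
  unfolding cls_def by (simp add: qsem.abs_eq lopp.refl eq_onp_def)

lemma qar_cls: "wf C \<Longrightarrow> qar (cls C) = ar C"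
  unfolding cls_def by (simp add: qar.abs_eq lopp.refl eq_onp_def)

lemma cls_Par: "wf C1 \<Longrightarrow> wf C2 \<Longrightarrow> cls (Par C1 C2) = cls C1 \<parallel> cls C2"
  unfolding cls_def by (simp add: qpar.abs_eq lopp.refl eq_onp_def)

lemma cls_Seq: "wf C1 \<Longrightarrow> wf C2 \<Longrightarrow> ar C1 = ar C2 \<Longrightarrow> cls (Seq C2 C1) = cls C2 \<diamond> cls C1"
  unfolding cls_def by (simp add: qseq.abs_eq lopp.refl eq_onp_def)

lemma cls_Ph: "cls (Ph p) = qph p"
  unfolding cls_def by (simp add: qph.abs_eq)

lemma cls_Bs: "cls (Bs p) = qbs p"
  unfolding cls_def by (simp add: qbs.abs_eq)

lemma cls_idk: "cls (idk n) = qid n"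
  unfolding cls_def by (simp add: qid.abs_eq)

lemma qcirc_cases: obtains C where "wf C" "x = cls C"
  unfolding cls_def by (metis Quotient3_abs_rep Quotient3_qcirc Quotient3_rep_reflp lopp_self_iff)

lemma cls_E: "cls E = qid 0"
  using cls_idk[of 0] by simp

lemma cls_Idw: "cls Idw = qid 1"
proof -
  have "cls Idw = cls (Par E Idw)"
    using lopp.sym[OF lopp.e_left[of Idw]] by (subst cls_eq_iff) simp_all
  then show ?thesis
    using cls_idk[of 1] by simp
qed

text \<open>Axiom (C) eliminates swaps, leaving phases and beam splitters as the only
  generators.\<close>

lemma cls_Sw: "cls Sw = (qph (-pi/2) \<parallel> qph (-pi/2)) \<diamond> qbs (pi/2)"
proof -
  have "cls Sw = cls (Seq (Par (Ph (-pi/2)) (Ph (-pi/2))) (Bs (pi/2)))"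
    using lopp.ax_C by (subst cls_eq_iff) simp_all
  then show ?thesis
    by (simp add: cls_Seq cls_Par cls_Ph cls_Bs)
qed

lemma qar_simps [simp]:
  "qar x = qar y \<Longrightarrow> qar (x \<diamond> y) = qar y" "qar (x \<parallel> y) = qar x + qar y"
  "qar (qph p) = 1" "qar (qbs p) = 2" "qar (qid n) = n"
  by (transfer, simp)+

lemma qseq_assoc:
  "qar x = qar y \<Longrightarrow> qar y = qar z \<Longrightarrow> (x \<diamond> y) \<diamond> z = x \<diamond> (y \<diamond> z)"
  by transfer (auto simp: lopp_self_iff intro!: lopp.seq_assoc)

lemma qid_left [simp]: "qar x = n \<Longrightarrow> qid n \<diamond> x = x"
  by transfer (auto simp: lopp_self_iff intro!: lopp.id_left)

lemma qid_right [simp]: "qar x = n \<Longrightarrow> x \<diamond> qid n = x"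
  by transfer (auto simp: lopp_self_iff intro!: lopp.id_right)

lemma qpar_assoc: "(x \<parallel> y) \<parallel> z = x \<parallel> (y \<parallel> z)"
  by transfer (auto simp: lopp_self_iff intro!: lopp.par_assoc)

lemma qid0_left [simp]: "qid 0 \<parallel> x = x"
  by transfer (auto simp: lopp_self_iff intro!: lopp.e_left)

lemma qid0_right [simp]: "x \<parallel> qid 0 = x"
  by transfer (auto simp: lopp_self_iff intro!: lopp.e_right)

lemma interchange:
  "qar x = qar y \<Longrightarrow> qar z = qar w \<Longrightarrow> (x \<parallel> z) \<diamond> (y \<parallel> w) = (x \<diamond> y) \<parallel> (z \<diamond> w)"
  by transfer (auto simp: lopp_self_iff intro!: lopp.interchange[THEN lopp.sym])

lemma qph_add: "qph a \<diamond> qph b = qph (a + b)"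
proof -
  have "lopp (Seq (Ph a) (Ph b)) (Ph (a + b))"
    using lopp.ax_D[of a b] by (simp add: add.commute)
  then show ?thesis
    by transfer simp
qed

lemma qid_Suc: "qid (Suc n) = qid n \<parallel> qid 1"
proof -
  have "cls (idk (Suc n)) = cls (idk n) \<parallel> cls Idw" by (simp add: cls_Par)
  then show ?thesis by (simp add: cls_idk cls_Idw del: idk.simps)
qed

lemma qid_add: "qid n \<parallel> qid m = qid (n + m)"
proof (induction m)
  case (Suc m)
  have "qid n \<parallel> qid (Suc m) = (qid n \<parallel> qid m) \<parallel> qid 1"
    by (simp only: qid_Suc[of m] qpar_assoc)
  then show ?case by (simp only: Suc add_Suc_right qid_Suc[of "n + m"])
qed simp

lemma qph_0: "qph 0 = qid 1"
  using cls_eq_iff[of "Ph 0" Idw] by (simp add: lopp.ax_A0 cls_Ph cls_Idw)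

lemma qph_2pi: "qph (2 * pi) = qid 1"
  using cls_eq_iff[of "Ph (2 * pi)" Idw] by (simp add: lopp.ax_A2pi cls_Ph cls_Idw)

lemma qbs_0: "qbs 0 = qid 2"
proof -
  have "cls (Bs 0) = cls (Par Idw Idw)"
    by (subst cls_eq_iff) (auto intro: lopp.ax_B)
  then show ?thesis by (simp add: cls_Bs cls_Par cls_Idw qid_add numeral_2_eq_2)
qed

text \<open>The angle is an integer multiple of \<open>2 * pi\<close>. Nonnegative multiples follow
  from axioms (A) and (D) by induction, negative ones by cancelling against the opposite
  angle.\<close>

lemma qph_cis1: "cis a = 1 \<Longrightarrow> qph a = qid 1"
proof -
  have n: "qph (2 * pi * real n) = qid 1" for n
  proof (induction n)
    case (Suc n)
    have "qph (2 * pi * real (Suc n)) = qph (2 * pi) \<diamond> qph (2 * pi * real n)"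
      by (simp add: qph_add algebra_simps)
    then show ?case by (simp only: Suc qph_2pi) simp
  qed (simp add: qph_0)
  assume "cis a = 1"
  then have "cos a = 1" by (simp add: complex_eq_iff)
  then obtain k :: int where k: "a = of_int k * 2 * pi"
    by (auto simp: cos_one_2pi_int)
  show ?thesis
  proof (cases "k \<ge> 0")
    case True
    then have "a = 2 * pi * real (nat k)" using k by simp
    then show ?thesis using n by simp
  next
    case False
    then have "- a = 2 * pi * real (nat (- k))" using k by simp
    then have "qph (- a) = qid 1" using n by simp
    then have "qph a = qph a \<diamond> qph (- a)" by simp
    also have "\<dots> = qid 1" by (simp add: qph_add qph_0)
    finally show ?thesis .
  qed
qed

subsection \<open>Generators\<close>

primrec D :: "nat \<Rightarrow> (nat \<Rightarrow> real) \<Rightarrow> qcirc" where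
  "D 0 f = qid 0"
| "D (Suc n) f = qph (f 0) \<parallel> D n (\<lambda>i. f (Suc i))"

text \<open>\<open>B n k t\<close> is the beam splitter on modes \<open>k\<close>, \<open>k + 1\<close> of \<open>n\<close>; it is the identity if \<open>n < k + 2\<close>.\<close>

fun B :: "nat \<Rightarrow> nat \<Rightarrow> real \<Rightarrow> qcirc" where
  "B (Suc (Suc n)) 0 t = qbs t \<parallel> qid n"
| "B (Suc n) (Suc k) t = qid 1 \<parallel> B n k t"
| "B n k t = qid n"

lemma qar_D [simp]: "qar (D n f) = n"
  by (induction n arbitrary: f) auto

lemma qar_B [simp]: "qar (B n k t) = n"
  by (induction n k t rule: B.induct) auto

lemma D_cong: "(\<And>i. i < n \<Longrightarrow> f i = g i) \<Longrightarrow> D n f = D n g"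
proof (induction n arbitrary: f g)
  case (Suc n)
  have "D n (\<lambda>i. f (Suc i)) = D n (\<lambda>i. g (Suc i))"
    using Suc.prems by (intro Suc.IH) simp
  then show ?case using Suc.prems[of 0] by simp
qed simp

lemma D_mult: "D n f \<diamond> D n g = D n (\<lambda>i. f i + g i)"
  by (induction n arbitrary: f g) (auto simp: interchange qph_add)

lemma D_one: "(\<And>i. i < n \<Longrightarrow> cis (f i) = 1) \<Longrightarrow> D n f = qid n"
proof (induction n arbitrary: f)
  case (Suc n)
  have "qph (f 0) = qid 1"
    using Suc.prems[of 0] by (intro qph_cis1) simp
  moreover have "D n (\<lambda>i. f (Suc i)) = qid n"
    using Suc.prems by (intro Suc.IH) simp
  ultimately show ?case by (simp add: qid_add)
qed auto

lemma D_shift: "qid 1 \<parallel> D n f = D (Suc n) (case_nat 0 f)"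
  by (simp add: qph_0)

lemma qbs_qph_commute: "qbs t \<diamond> (qph p \<parallel> qph p) = (qph p \<parallel> qph p) \<diamond> qbs t"
proof -
  have "cls (Seq (Bs t) (Par (Ph p) (Ph p))) = cls (Seq (Par (Ph p) (Ph p)) (Bs t))"
    by (subst cls_eq_iff) (auto intro: lopp.ax_E)
  then show ?thesis by (simp add: cls_Seq cls_Par cls_Ph cls_Bs)
qed

text \<open>Axiom (E) on the two modes of the beam splitter, interchange on all the others.\<close>

lemma B_D_commute: "f k = f (Suc k) \<Longrightarrow> B n k t \<diamond> D n f = D n f \<diamond> B n k t"
proof (induction n k t arbitrary: f rule: B.induct)
  case (1 n t)
  have "D (Suc (Suc n)) f = (qph (f 0) \<parallel> qph (f 0)) \<parallel> D n (\<lambda>i. f (Suc (Suc i)))"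
    using 1 by (simp add: qpar_assoc)
  then show ?case
    by (simp add: interchange qbs_qph_commute del: D.simps)
next
  case (2 n k t)
  then show ?case by (simp add: interchange)
qed auto

section \<open>Padding, and generation of all circuits by phase layers and beam splitters\<close>

lemma B_oob: "n < k + 2 \<Longrightarrow> B n k t = qid n"
  by (induction n k t rule: B.induct) (auto simp: qid_add)

lemma D_pad: "D n f \<parallel> qid m = D (n + m) (\<lambda>i. if i < n then f i else 0)"
proof (induction n arbitrary: f)
  case 0
  show ?case by (simp add: D_one)
next
  case (Suc n)
  have "D (n + m) (\<lambda>i. if Suc i < Suc n then f (Suc i) else 0) = D n (\<lambda>i. f (Suc i)) \<parallel> qid m"
    unfolding Suc by (rule D_cong) auto
  then show ?case
    by (simp add: qpar_assoc)
qed

lemma B_pad: "k + 2 \<le> n \<Longrightarrow> B n k t \<parallel> qid m = B (n + m) k t"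
  by (induction n k t rule: B.induct) (auto simp: qpar_assoc qid_add)

text \<open>Words in the generators, built on the left one letter at a time; with
  \<open>gen_all\<close> this is the induction principle for classes of circuits.\<close>

inductive gen :: "nat \<Rightarrow> qcirc \<Rightarrow> bool" for n where
  gen_id: "gen n (qid n)"
| gen_D: "gen n x \<Longrightarrow> gen n (D n f \<diamond> x)"
| gen_B: "gen n x \<Longrightarrow> gen n (B n k t \<diamond> x)"

lemma gen_qar: "gen n x \<Longrightarrow> qar x = n"
  by (induction rule: gen.induct) auto

lemma gen_seq: "gen n x \<Longrightarrow> gen n y \<Longrightarrow> gen n (x \<diamond> y)"
proof (induction rule: gen.induct)
  case gen_id
  then show ?case by (simp add: gen_qar)
qed (simp_all add: qseq_assoc gen_qar gen.intros)

lemma gen_D0: "gen n (D n f)" and gen_B0: "gen n (B n k t)"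
  using gen.gen_D[OF gen_id, of n f] gen.gen_B[OF gen_id, of n k t] by auto

lemma gen_shift: "gen n x \<Longrightarrow> gen (Suc n) (qid 1 \<parallel> x)"
proof (induction rule: gen.induct)
  case gen_id
  then show ?case using gen.gen_id[of "Suc n"] by (simp add: qid_add)
next
  case (gen_D x f)
  have "qid 1 \<parallel> (D n f \<diamond> x) = (qid 1 \<parallel> D n f) \<diamond> (qid 1 \<parallel> x)"
    by (simp add: interchange gen_qar[OF gen_D(1)])
  then show ?case using gen_D by (simp only: D_shift gen.gen_D)
next
  case (gen_B x k t)
  have "qid 1 \<parallel> (B n k t \<diamond> x) = B (Suc n) (Suc k) t \<diamond> (qid 1 \<parallel> x)"
    by (simp add: interchange gen_qar[OF gen_B(1)])
  then show ?case using gen_B by (simp only: gen.gen_B)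
qed

lemma gen_shifts: "gen n x \<Longrightarrow> gen (m + n) (qid m \<parallel> x)"
proof (induction m)
  case (Suc m)
  have "qid (Suc m) \<parallel> x = qid 1 \<parallel> (qid m \<parallel> x)"
    using qid_add[of 1 m] by (simp flip: qpar_assoc)
  then show ?case using gen_shift[OF Suc.IH[OF Suc.prems]] by simp
qed simp

lemma gen_pad: "gen n x \<Longrightarrow> gen (n + m) (x \<parallel> qid m)"
proof (induction rule: gen.induct)
  case gen_id
  then show ?case using gen.gen_id[of "n + m"] by (simp add: qid_add)
next
  case (gen_D x f)
  have "(D n f \<diamond> x) \<parallel> qid m = (D n f \<parallel> qid m) \<diamond> (x \<parallel> qid m)"
    by (simp add: interchange gen_qar[OF gen_D(1)])
  then show ?case using gen_D by (simp only: D_pad gen.gen_D)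
next
  case (gen_B x k t)
  have "(B n k t \<diamond> x) \<parallel> qid m = (B n k t \<parallel> qid m) \<diamond> (x \<parallel> qid m)"
    by (simp add: interchange gen_qar[OF gen_B(1)])
  moreover have "gen (n + m) (B n k t \<parallel> qid m)"
  proof (cases "k + 2 \<le> n")
    case True
    then show ?thesis by (simp add: B_pad gen_B0)
  next
    case False
    then show ?thesis using gen.gen_id[of "n + m"] by (simp add: B_oob qid_add)
  qed
  ultimately show ?case using gen_B by (simp add: gen_seq)
qed

lemma gen_par:
  assumes "gen n x" "gen m y"
  shows "gen (n + m) (x \<parallel> y)"
proof -
  have "x \<parallel> y = (x \<parallel> qid m) \<diamond> (qid n \<parallel> y)"
    using assms by (simp add: interchange gen_qar)
  then show ?thesis
    using gen_seq[OF gen_pad[OF assms(1)] gen_shifts[OF assms(2)]] by simp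
qed

lemma qph_gen: "gen 1 (qph p)"
  using gen_D0[of 1 "\<lambda>_. p"] by simp

lemma qbs_gen: "gen 2 (qbs p)"
  using gen_B0[of 2 0 p] by (simp add: numeral_2_eq_2)

lemma gen_cls: "wf C \<Longrightarrow> gen (ar C) (cls C)"
proof (induction C)
  case Sw
  have "gen (1 + 1) (qph (-pi/2) \<parallel> qph (-pi/2))" by (intro gen_par qph_gen)
  then show ?case using gen_seq[OF _ qbs_gen] by (simp add: cls_Sw numeral_2_eq_2)
next
  case Idw
  then show ?case using gen.gen_id[of 1] by (simp add: cls_Idw)
next
  case E
  then show ?case using gen.gen_id[of 0] by (simp add: cls_E)
next
  case (Ph p)
  then show ?case using qph_gen by (simp add: cls_Ph)
next
  case (Bs t)
  then show ?case using qbs_gen by (simp add: cls_Bs)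
next
  case (Seq C2 C1)
  then show ?case by (simp add: cls_Seq gen_seq)
next
  case (Par C1 C2)
  then show ?case by (simp add: cls_Par gen_par)
qed

lemma gen_all: "gen (qar x) x"
  by (metis gen_cls qar_cls qcirc_cases)

section \<open>Factorization along the stabilizer of the first mode\<close>

text \<open>Since suitable angles always exist, (F) becomes a rewrite without side conditions; later
  steps never need the ranges of the angles.\<close>

lemma axiom_F:
  obtains b1 b2 b3 b4 where
    "qbs a3 \<diamond> ((qph a2 \<parallel> qid 1) \<diamond> qbs a1) = (qph b3 \<parallel> qph b4) \<diamond> (qbs b2 \<diamond> (qph b1 \<parallel> qid 1))"
proof -
  obtain b1 b2 b3 b4 where "F_cond a1 a2 a3 b1 b2 b3 b4"
    using F_angles_exist by blast
  then have "cls (F_lhs a1 a2 a3) = cls (F_rhs b1 b2 b3 b4)"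
    using lopp.ax_F lopp_wf cls_eq_iff by metis
  then show ?thesis
    by (intro that) (simp add: F_lhs_def F_rhs_def cls_Seq cls_Par cls_Ph cls_Bs cls_Idw)
qed

lemma cls_B01: "cls (B01 t) = B 3 0 t"
  by (simp add: B01_def cls_Par cls_Bs cls_Idw numeral_3_eq_3)

lemma cls_B12: "cls (B12 t) = B 3 1 t"
  by (simp add: B12_def cls_Par cls_Bs cls_Idw numeral_3_eq_3)

lemma cls_Phi0: "cls (Phi0 t) = D 3 (\<lambda>i. if i = 0 then t else 0)"
  by (simp add: Phi0_def cls_Par cls_Ph cls_Idw numeral_3_eq_3 qph_0)

lemma cls_Phi1: "cls (Phi1 t) = D 3 (\<lambda>i. if i = 1 then t else 0)"
  by (simp add: Phi1_def cls_Par cls_Ph cls_Idw numeral_3_eq_3 qph_0)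

lemma cls_Phi2: "cls (Phi2 t) = D 3 (\<lambda>i. if i = 2 then t else 0)"
  by (simp add: Phi2_def cls_Par cls_Ph cls_Idw numeral_3_eq_3 qph_0)

lemma three_mode_wf [simp]:
  "wf (B01 t)" "wf (B12 t)" "wf (Phi0 t)" "wf (Phi1 t)" "wf (Phi2 t)"
  "ar (B01 t) = 3" "ar (B12 t) = 3" "ar (Phi0 t) = 3" "ar (Phi1 t) = 3" "ar (Phi2 t) = 3"
  by (simp_all add: B01_def B12_def Phi0_def Phi1_def Phi2_def)

lemma D_mult_left: "qar x = n \<Longrightarrow> D n f \<diamond> (D n g \<diamond> x) = D n (\<lambda>i. f i + g i) \<diamond> x"
  by (simp add: D_mult flip: qseq_assoc)

lemma seq_pad: "qar x = qar y \<Longrightarrow> (x \<diamond> y) \<parallel> qid n = (x \<parallel> qid n) \<diamond> (y \<parallel> qid n)"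
  by (simp add: interchange)

lemma seq_shift: "qar x = qar y \<Longrightarrow> qid 1 \<parallel> (x \<diamond> y) = (qid 1 \<parallel> x) \<diamond> (qid 1 \<parallel> y)"
  by (simp add: interchange)

text \<open>Adjacent phase shifters of (G) are merged into layers: angles 7 to 9 form
  \<open>f1\<close>, angle 5 forms \<open>f2\<close>, angles 1 and 2 form \<open>f3\<close>.\<close>

lemma axiom_G3:
  obtains f1 f2 f3 b b' b'' where
    "B 3 0 g4 \<diamond> (B 3 1 g3 \<diamond> (D 3 (\<lambda>i. if i = 0 then g2 else 0) \<diamond> B 3 0 g1)) =
     D 3 f1 \<diamond> (B 3 1 b \<diamond> (D 3 f2 \<diamond> (B 3 0 b' \<diamond> (B 3 1 b'' \<diamond> D 3 f3))))"
proof -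
  obtain d where "G_cond g1 g2 g3 g4 d"
    using G_angles_exist by blast
  then have "cls (G_lhs g1 g2 g3 g4) = cls (G_rhs d)"
    using lopp.ax_G lopp_wf cls_eq_iff by metis
  then show ?thesis
    by (intro that) (simp add: G_lhs_def G_rhs_def cls_Seq cls_B01 cls_B12 cls_Phi0 cls_Phi1
        cls_Phi2 D_mult D_mult_left del: D.simps B.simps)
qed

lemma axiom_G:
  assumes "N = 3 + n"
  obtains f1 f2 f3 b b' b'' where
    "B N 0 g4 \<diamond> (B N 1 g3 \<diamond> (D N (\<lambda>i. if i = 0 then g2 else 0) \<diamond> B N 0 g1)) =
     D N f1 \<diamond> (B N 1 b \<diamond> (D N f2 \<diamond> (B N 0 b' \<diamond> (B N 1 b'' \<diamond> D N f3))))"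
proof -
  obtain f1 f2 f3 b b' b'' where
    "B 3 0 g4 \<diamond> (B 3 1 g3 \<diamond> (D 3 (\<lambda>i. if i = 0 then g2 else 0) \<diamond> B 3 0 g1)) =
     D 3 f1 \<diamond> (B 3 1 b \<diamond> (D 3 f2 \<diamond> (B 3 0 b' \<diamond> (B 3 1 b'' \<diamond> D 3 f3))))"
    by (rule axiom_G3)
  \<comment> \<open>Identity wires below extend each phase layer by zeros, whence the tests
    \<open>i < 3\<close>.\<close>
  from arg_cong[OF this, of "\<lambda>x. x \<parallel> qid n"]
  have "B N 0 g4 \<diamond> (B N 1 g3 \<diamond> (D N (\<lambda>i. if i < 3 then if i = 0 then g2 else 0 else 0) \<diamond> B N 0 g1)) =
     D N (\<lambda>i. if i < 3 then f1 i else 0) \<diamond> (B N 1 b \<diamond> (D N (\<lambda>i. if i < 3 then f2 i else 0)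
       \<diamond> (B N 0 b' \<diamond> (B N 1 b'' \<diamond> D N (\<lambda>i. if i < 3 then f3 i else 0)))))"
    by (simp add: seq_pad D_pad B_pad assms del: D.simps B.simps)
  moreover have "D N (\<lambda>i. if i < 3 then if i = 0 then g2 else 0 else 0) = D N (\<lambda>i. if i = 0 then g2 else 0)"
    by (rule D_cong) simp
  ultimately show ?thesis
    by (intro that) simp
qed

text \<open>Axiom (B) only covers the angle 0. The other multiples of \<open>pi\<close> come from an
  instance of (F) whose right-hand side has a trivial beam splitter and two equal phases.\<close>

lemma qbs_diagonal:
  assumes "sin t = 0"
  obtains c where "cis c = of_real (cos t)" "qbs t = qph c \<parallel> qph c"
proof -
  \<comment> \<open>The cosine is 1 or -1, and \<open>c\<close> is its argument in the range that
    \<open>F_cond\<close> prescribes.\<close>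
  define c where "c = (if cos t = 1 then 0 else pi)"
  have "cos t = 1 \<or> cos t = -1"
    using assms sin_cos_squared_add[of t] by (simp add: power2_eq_1_iff)
  then have cc: "cis c = of_real (cos t)" and c: "0 \<le> c" "c < 2 * pi"
    by (auto simp: c_def)
  have "sem (Bs t) = diag2 (cis c) (cis c)"
    by (rule mat_eqI2) (simp_all add: diag2_index cc assms)
  moreover have "sem (Bs 0) = diag2 1 1"
    by (rule mat_eqI2) (simp_all add: diag2_index)
  ultimately have "F_cond 0 0 t 0 0 c c"
    unfolding F_cond_def F_lhs_def F_rhs_def sem_Par sem.simps(3,6) dsum_Ph_Ph dsum_Ph_Idw
    using c pi_gt_zero by (simp add: diag2_mult del: sem.simps)
  then have "cls (F_lhs 0 0 t) = cls (F_rhs 0 0 c c)"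
    using lopp.ax_F lopp_wf cls_eq_iff by metis
  then have "qbs t = qph c \<parallel> qph c"
    by (simp add: F_lhs_def F_rhs_def cls_Seq cls_Par cls_Ph cls_Bs cls_Idw qph_0 qbs_0 qid_add
        flip: numeral_2_eq_2)
  then show ?thesis using cc that by blast
qed

text \<open>An instance of (F) in which all angles on the right are 0.\<close>

lemma qbs_inverse: "qbs (- t) \<diamond> qbs t = qid 2"
proof -
  have "sem (Bs (- t)) * sem (Bs t) = diag2 1 1"
    by (rule mult_eqI2) (use cos_sin_mult_self[of t] in \<open>simp_all add: diag2_index algebra_simps\<close>)
  moreover have "sem (Bs 0) = diag2 1 1"
    by (rule mat_eqI2) (simp_all add: diag2_index)
  moreover have "diag2 1 1 * sem (Bs t) = sem (Bs t)"
    by (rule mult_eqI2) (simp_all add: diag2_index)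
  ultimately have "F_cond t 0 (- t) 0 0 0 0"
    unfolding F_cond_def F_lhs_def F_rhs_def sem_Par sem.simps(3,6) dsum_Ph_Ph dsum_Ph_Idw
    using pi_gt_zero by (simp add: diag2_mult del: sem.simps)
  then have "cls (F_lhs t 0 (- t)) = cls (F_rhs 0 0 0 0)"
    using lopp.ax_F lopp_wf cls_eq_iff by metis
  then show ?thesis
    by (simp add: F_lhs_def F_rhs_def cls_Seq cls_Par cls_Ph cls_Bs cls_Idw qph_0 qbs_0 qid_add
        flip: numeral_2_eq_2)
qed

lemma B_inverse: "B n k (- t) \<diamond> B n k t = qid n"
  by (induction n k t rule: B.induct) (simp_all add: interchange qbs_inverse qid_add)

lemma B_zero: "B n k 0 = qid n"
  by (induction n k "0::real" rule: B.induct) (simp_all add: qbs_0 qid_add)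

lemma D_fix0: "f 0 = 0 \<Longrightarrow> D (Suc n) f = qid 1 \<parallel> D n (\<lambda>i. f (Suc i))"
  by (simp add: qph_0)

text \<open>The first factor is constant from mode \<open>j\<close> downwards and the second is
  trivial on the modes up to \<open>j\<close>, so they commute with different beam
  splitters.\<close>

lemma D_split: "D n f = D n (\<lambda>i. f (min i j)) \<diamond> D n (\<lambda>i. f i - f (min i j))"
  unfolding D_mult by (rule D_cong) simp

lemma commute_left:
  "a \<diamond> b = b \<diamond> a \<Longrightarrow> qar a = qar b \<Longrightarrow> qar x = qar b \<Longrightarrow> a \<diamond> (b \<diamond> x) = b \<diamond> (a \<diamond> x)"
  by (metis qseq_assoc)

subsection \<open>Ladders\<close>

text \<open>\<open>Lad m t\<close> is a staircase of \<open>m\<close> beam splitters on \<open>m + 1\<close> modes; \<open>t i\<close> is the angle on modes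
  \<open>i\<close>, \<open>i + 1\<close>, and \<open>t 0\<close> acts first.\<close>

primrec Lad :: "nat \<Rightarrow> (nat \<Rightarrow> real) \<Rightarrow> qcirc" where
  "Lad 0 t = qid 1"
| "Lad (Suc m) t = (qid 1 \<parallel> Lad m (\<lambda>i. t (Suc i))) \<diamond> B (Suc (Suc m)) 0 (t 0)"

lemma qar_Lad [simp]: "qar (Lad m t) = Suc m"
  by (induction m arbitrary: t) (auto simp del: B.simps)

lemma Lad_zero: "Lad m (\<lambda>_. 0) = qid (Suc m)"
  by (induction m) (auto simp: B_zero qid_add simp del: B.simps)

text \<open>By (E), a phase common to all modes passes every beam splitter of the staircase.\<close>

lemma Lad_const_commute: "Lad m t \<diamond> D (Suc m) (\<lambda>_. c) = D (Suc m) (\<lambda>_. c) \<diamond> Lad m t"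
proof (induction m arbitrary: t)
  case (Suc m)
  let ?N = "Suc (Suc m)" and ?L = "qid 1 \<parallel> Lad m (\<lambda>i. t (Suc i))" and ?c = "\<lambda>_. c"
  have L: "?L \<diamond> D ?N ?c = D ?N ?c \<diamond> ?L"
    by (subst (1 2) D.simps(2)) (simp add: interchange Suc del: D.simps)
  have "Lad (Suc m) t \<diamond> D ?N ?c = ?L \<diamond> (B ?N 0 (t 0) \<diamond> D ?N ?c)"
    by (simp add: qseq_assoc del: D.simps B.simps)
  also have "\<dots> = ?L \<diamond> (D ?N ?c \<diamond> B ?N 0 (t 0))"
    by (simp only: B_D_commute)
  also have "\<dots> = D ?N ?c \<diamond> (?L \<diamond> B ?N 0 (t 0))"
    by (rule commute_left[OF L]) (simp_all del: D.simps B.simps)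
  finally show ?case by simp
qed simp

text \<open>A representative of a coset of the circuits that fix mode 0: \<open>h\<close> is
  arbitrary and the angles are not made unique.\<close>

definition NF :: "nat \<Rightarrow> qcirc \<Rightarrow> bool" where
  "NF m x \<longleftrightarrow> (\<exists>f t h. qar h = m \<and> x = D (Suc m) f \<diamond> (Lad m t \<diamond> (qid 1 \<parallel> h)))"

lemma NF_D: "NF m x \<Longrightarrow> NF m (D (Suc m) f \<diamond> x)"
proof -
  assume "NF m x"
  then obtain g t h where h: "qar h = m" "x = D (Suc m) g \<diamond> (Lad m t \<diamond> (qid 1 \<parallel> h))"
    by (auto simp: NF_def)
  then have "D (Suc m) f \<diamond> x = D (Suc m) (\<lambda>i. f i + g i) \<diamond> (Lad m t \<diamond> (qid 1 \<parallel> h))"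
    by (simp add: D_mult_left del: D.simps)
  then show ?thesis
    unfolding NF_def using h(1) by blast
qed

lemma NF_stab:
  assumes "NF m x" "qar h = m"
  shows "NF m (x \<diamond> (qid 1 \<parallel> h))"
proof -
  obtain f t h' where h': "qar h' = m" "x = D (Suc m) f \<diamond> (Lad m t \<diamond> (qid 1 \<parallel> h'))"
    using assms(1) by (auto simp: NF_def)
  have "x \<diamond> (qid 1 \<parallel> h) = D (Suc m) f \<diamond> (Lad m t \<diamond> (qid 1 \<parallel> (h' \<diamond> h)))"
    using h' assms(2) by (simp add: qseq_assoc interchange del: D.simps)
  moreover have "qar (h' \<diamond> h) = m" using h' assms(2) by simp
  ultimately show ?thesis unfolding NF_def by blast
qed

lemma NF_Lad: "NF m (D (Suc m) f \<diamond> Lad m t)"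
  unfolding NF_def
  by (intro exI[of _ f] exI[of _ t] exI[of _ "qid m"]) (simp add: qid_add del: D.simps)

lemma NF_id: "NF m (qid (Suc m))"
proof -
  have "D (Suc m) (\<lambda>_. 0) = qid (Suc m)" by (rule D_one) simp
  then have "qid (Suc m) = D (Suc m) (\<lambda>_. 0) \<diamond> Lad m (\<lambda>_. 0)" by (simp add: Lad_zero del: D.simps)
  then show ?thesis using NF_Lad by metis
qed

abbreviation single :: "nat \<Rightarrow> real \<Rightarrow> nat \<Rightarrow> real" where
  "single k a \<equiv> (\<lambda>i. if i = k then a else 0)"

text \<open>After (F), the phase \<open>b1\<close> on the right is written as \<open>b1\<close> on
  both modes, which moves left by (E), followed by \<open>- b1\<close> on the lower mode, which
  fixes mode 0 and joins \<open>h\<close>.\<close>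

lemma NF_B0_two: "NF 1 (B 2 0 s \<diamond> (D 2 (single 0 a) \<diamond> Lad 1 t))"
proof -
  obtain b1 b2 b3 b4 where F: "qbs s \<diamond> ((qph a \<parallel> qid 1) \<diamond> qbs (t 0)) =
      (qph b3 \<parallel> qph b4) \<diamond> (qbs b2 \<diamond> (qph b1 \<parallel> qid 1))"
    by (rule axiom_F)
  have B2: "B 2 0 u = qbs u" for u by (simp add: numeral_2_eq_2)
  have D2: "D 2 f = qph (f 0) \<parallel> qph (f 1)" for f by (simp add: numeral_2_eq_2)
  have L: "Lad 1 u = B 2 0 (u 0)" for u
    by (simp add: qid_add numeral_2_eq_2 del: B.simps)
  have "qph b1 \<parallel> qid 1 = (qph b1 \<parallel> qph b1) \<diamond> (qid 1 \<parallel> qph (- b1))"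
    by (simp add: interchange qph_add qph_0)
  then have "qbs b2 \<diamond> (qph b1 \<parallel> qid 1) = (qph b1 \<parallel> qph b1) \<diamond> (qbs b2 \<diamond> (qid 1 \<parallel> qph (- b1)))"
    using commute_left[OF qbs_qph_commute[of b2 b1], where x = "qid 1 \<parallel> qph (- b1)"]
    by simp
  then have "B 2 0 s \<diamond> (D 2 (single 0 a) \<diamond> Lad 1 t)
      = D 2 (\<lambda>i. if i = 0 then b3 else b4) \<diamond> (D 2 (\<lambda>_. b1) \<diamond> (Lad 1 (\<lambda>_. b2) \<diamond> (qid 1 \<parallel> qph (- b1))))"
    unfolding L B2 D2 using F by (simp add: qph_0)
  also have "\<dots> = D (Suc 1) (\<lambda>i. if i = 0 then b3 else b4)
     \<diamond> (D (Suc 1) (\<lambda>_. b1) \<diamond> Lad 1 (\<lambda>_. b2)) \<diamond> (qid 1 \<parallel> qph (- b1))"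
    by (simp only: qseq_assoc qar_simps qar_D qar_Lad one_add_one Suc_1)
  finally show ?thesis
    using NF_D[OF NF_stab[OF NF_Lad[of 1 "\<lambda>_. b1" "\<lambda>_. b2"], of "qph (- b1)"],
        of "\<lambda>i. if i = 0 then b3 else b4"] by simp
qed

text \<open>Axiom (G) applies to the top three modes once the tail of the staircase has been moved
  out of the way. Of the three new beam splitters, the two later ones restart the staircase and the
  earliest, on modes 1 and 2, joins \<open>h\<close>; the phases move left into the layer or right
  into \<open>h\<close>.\<close>

lemma NF_B0_many:
  fixes n defines "N \<equiv> 3 + n"
  shows "NF (2 + n) (B N 0 s \<diamond> (D N (single 0 a) \<diamond> Lad (2 + n) t))"
proof -
  \<comment> \<open>The tail of the staircase after its first two beam splitters; it does not touch
    modes 0 and 1.\<close>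
  define M where "M u = (qid 2 \<parallel> Lad n u :: qcirc)" for u
  let ?P = "single 0 a"
  have N: "N = Suc (Suc (Suc n))" "Suc (2 + n) = N" by (auto simp: N_def)
  have M: "qar (M u) = N" for u by (simp add: M_def N)
  have L: "Lad (2 + n) u = M (\<lambda>i. u (i + 2)) \<diamond> (B N 1 (u 1) \<diamond> B N 0 (u 0))" for u
  proof -
    have "qid (Suc 0) \<parallel> qid (Suc 0) = qid 2" by (simp add: qid_add numeral_2_eq_2)
    then have "Lad (2 + n) u = (qid 1 \<parallel> ((qid 1 \<parallel> Lad n (\<lambda>i. u (i + 2))) \<diamond> B (Suc (Suc n)) 0 (u 1))) \<diamond> B N 0 (u 0)"
      by (simp add: N numeral_2_eq_2 del: B.simps)
    also have "\<dots> = (M (\<lambda>i. u (i + 2)) \<diamond> B N 1 (u 1)) \<diamond> B N 0 (u 0)"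
    proof -
      have "qid 1 \<parallel> (qid 1 \<parallel> x) = qid 2 \<parallel> x" for x
        using qid_add[of 1 1] by (simp add: numeral_2_eq_2 flip: qpar_assoc)
      moreover have "qid 1 \<parallel> B (Suc (Suc n)) 0 (u 1) = B N 1 (u 1)"
        by (simp add: N)
      ultimately show ?thesis
        by (simp only: M_def seq_shift qar_simps qar_Lad qar_B plus_1_eq_Suc)
    qed
    finally show ?thesis by (simp add: qseq_assoc M del: B.simps)
  qed
  \<comment> \<open>On the modes of the tail such a layer is a common phase, while on modes 0 and 1
    the tail is the identity.\<close>
  have MD: "M u \<diamond> D N f = D N f \<diamond> M u" if "\<And>i. f (i + 2) = f 2" for f u
  proof -
    have "D (Suc n) (\<lambda>i. f (Suc (Suc i))) = D (Suc n) (\<lambda>_. f 2)"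
      by (rule D_cong) (use that in \<open>simp add: numeral_2_eq_2\<close>)
    then have "D N f = (qph (f 0) \<parallel> qph (f 1)) \<parallel> D (Suc n) (\<lambda>_. f 2)"
      unfolding N by (simp add: qpar_assoc D.simps(2)[of "Suc _"] del: D.simps)
    then show ?thesis
      unfolding M_def by (simp add: interchange Lad_const_commute del: D.simps)
  qed
  have MB: "M u \<diamond> B N 0 r = B N 0 r \<diamond> M u" for u r
    by (simp add: M_def N interchange)
  have DB: "D N f \<diamond> B N k r = B N k r \<diamond> D N f" if "f k = f (Suc k)" for f k r
    using B_D_commute[OF that] by simp
  let ?M = "M (\<lambda>i. t (i + 2))"
  obtain f1 f2 f3 b b' b'' where
    G: "B N 0 s \<diamond> (B N 1 (t 1) \<diamond> (D N ?P \<diamond> B N 0 (t 0))) =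
     D N f1 \<diamond> (B N 1 b \<diamond> (D N f2 \<diamond> (B N 0 b' \<diamond> (B N 1 b'' \<diamond> D N f3))))"
    by (rule axiom_G[OF meta_eq_to_obj_eq[OF N_def]])
  have "B N 0 s \<diamond> (D N ?P \<diamond> Lad (2 + n) t)
      = B N 0 s \<diamond> (D N ?P \<diamond> (?M \<diamond> (B N 1 (t 1) \<diamond> B N 0 (t 0))))"
    by (simp only: L)
  also have "\<dots> = B N 0 s \<diamond> (?M \<diamond> (D N ?P \<diamond> (B N 1 (t 1) \<diamond> B N 0 (t 0))))"
    by (subst commute_left[OF MD]) (simp_all add: M)
  also have "\<dots> = ?M \<diamond> (B N 0 s \<diamond> (B N 1 (t 1) \<diamond> (D N ?P \<diamond> B N 0 (t 0))))"
    by (subst commute_left[OF MB, symmetric], simp_all add: M,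
        subst commute_left[OF DB], simp_all)
  also have "\<dots> = ?M \<diamond> (D N f1 \<diamond> (B N 1 b \<diamond> (D N f2 \<diamond> (B N 0 b' \<diamond> (B N 1 b'' \<diamond> D N f3)))))"
    by (simp only: G)
  finally have 1: "B N 0 s \<diamond> (D N ?P \<diamond> Lad (2 + n) t) = \<dots>" .

  have stab: "\<exists>h. qar h = 2 + n \<and> D N r = qid 1 \<parallel> h" if "r 0 = 0" for r
    using D_fix0[of r "2 + n", OF that] by (intro exI[of _ "D (2 + n) (\<lambda>i. r (Suc i))"]) (simp add: N)
  \<comment> \<open>Each phase layer is split into a part that is constant from its slot downwards, which commutes
    with everything to its left, and a part that vanishes on the modes above, which moves to the right.\<close>
  let ?c = "\<lambda>i. f3 (min i 0)" and ?r3 = "\<lambda>i. f3 i - f3 (min i 0)"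
  obtain h3 where h3: "qar h3 = 2 + n" "D N ?r3 = qid 1 \<parallel> h3"
    using stab[of ?r3] by auto
  define f2' where "f2' = (\<lambda>i. f2 i + ?c i)"
  let ?g2 = "\<lambda>i. f2' (min i 1)" and ?r2 = "\<lambda>i. f2' i - f2' (min i 1)"
  obtain h2 where h2: "qar h2 = 2 + n" "D N ?r2 = qid 1 \<parallel> h2"
    using stab[of ?r2] by auto
  define f1' where "f1' = (\<lambda>i. f1 i + ?g2 i)"
  let ?g1 = "\<lambda>i. f1' (min i 2)" and ?r1 = "\<lambda>i. f1' i - f1' (min i 2)"
  obtain h1 where h1: "qar h1 = 2 + n" "D N ?r1 = qid 1 \<parallel> h1"
    using stab[of ?r1] by auto

  have "B N 1 b'' \<diamond> D N f3 = B N 1 b'' \<diamond> (D N ?c \<diamond> D N ?r3)"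
    by (simp only: D_split[of N f3 0])
  also have "\<dots> = D N ?c \<diamond> (B N 1 b'' \<diamond> D N ?r3)"
    by (subst commute_left[OF B_D_commute]) simp_all
  finally have "D N f2 \<diamond> (B N 0 b' \<diamond> (B N 1 b'' \<diamond> D N f3))
      = D N f2 \<diamond> (B N 0 b' \<diamond> (D N ?c \<diamond> (B N 1 b'' \<diamond> D N ?r3)))"
    by simp
  also have "\<dots> = D N f2 \<diamond> (D N ?c \<diamond> (B N 0 b' \<diamond> (B N 1 b'' \<diamond> D N ?r3)))"
    by (subst commute_left[OF B_D_commute]) simp_all
  also have "\<dots> = D N f2' \<diamond> (B N 0 b' \<diamond> (B N 1 b'' \<diamond> D N ?r3))"
    by (simp add: D_mult_left f2'_def)
  \<comment> \<open>Split at mode 1: \<open>?g2\<close> has equal phases on modes 1 and 2 and can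
    later pass \<open>B N 1 b\<close>, while \<open>?r2\<close> vanishes on modes 0 and 1 and passes
    \<open>B N 0 b'\<close>.\<close>
  also have "\<dots> = D N ?g2 \<diamond> (D N ?r2 \<diamond> (B N 0 b' \<diamond> (B N 1 b'' \<diamond> D N ?r3)))"
    by (subst D_split[of N f2' 1]) (simp add: qseq_assoc)
  also have "\<dots> = D N ?g2 \<diamond> (B N 0 b' \<diamond> (D N ?r2 \<diamond> (B N 1 b'' \<diamond> D N ?r3)))"
    by (subst commute_left[OF DB]) simp_all
  finally have 2: "D N f2 \<diamond> (B N 0 b' \<diamond> (B N 1 b'' \<diamond> D N f3)) = \<dots>" .
  let ?S = "D N ?r2 \<diamond> (B N 1 b'' \<diamond> D N ?r3)"
  have "D N f1 \<diamond> (B N 1 b \<diamond> (D N f2 \<diamond> (B N 0 b' \<diamond> (B N 1 b'' \<diamond> D N f3))))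
      = D N f1 \<diamond> (B N 1 b \<diamond> (D N ?g2 \<diamond> (B N 0 b' \<diamond> ?S)))"
    by (simp only: 2)
  also have "\<dots> = D N f1 \<diamond> (D N ?g2 \<diamond> (B N 1 b \<diamond> (B N 0 b' \<diamond> ?S)))"
    by (subst commute_left[OF B_D_commute]) simp_all
  also have "\<dots> = D N f1' \<diamond> (B N 1 b \<diamond> (B N 0 b' \<diamond> ?S))"
    by (simp add: D_mult_left f1'_def)
  \<comment> \<open>Split at mode 2: \<open>?g1\<close> can pass the tail \<open>?M\<close>, while
    \<open>?r1\<close> vanishes on modes 0 to 2 and passes both beam splitters.\<close>
  also have "\<dots> = D N ?g1 \<diamond> (D N ?r1 \<diamond> (B N 1 b \<diamond> (B N 0 b' \<diamond> ?S)))"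
    by (subst D_split[of N f1' 2]) (simp add: qseq_assoc)
  also have "\<dots> = D N ?g1 \<diamond> (B N 1 b \<diamond> (D N ?r1 \<diamond> (B N 0 b' \<diamond> ?S)))"
    by (subst commute_left[OF DB]) simp_all
  also have "\<dots> = D N ?g1 \<diamond> (B N 1 b \<diamond> (B N 0 b' \<diamond> (D N ?r1 \<diamond> ?S)))"
    by (subst commute_left[OF DB]) simp_all
  finally have "B N 0 s \<diamond> (D N ?P \<diamond> Lad (2 + n) t)
      = ?M \<diamond> (D N ?g1 \<diamond> (B N 1 b \<diamond> (B N 0 b' \<diamond> (D N ?r1 \<diamond> ?S))))"
    unfolding 1 by (simp only:)
  also have "\<dots> = D N ?g1 \<diamond> (?M \<diamond> (B N 1 b \<diamond> (B N 0 b' \<diamond> (D N ?r1 \<diamond> ?S))))"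
    by (subst commute_left[OF MD]) (simp_all add: M numeral_2_eq_2)
  finally have 3: "B N 0 s \<diamond> (D N ?P \<diamond> Lad (2 + n) t) = \<dots>" .
  \<comment> \<open>Only the first two angles of the staircase change, since the tail was carried
    along untouched.\<close>
  define u where "u = (\<lambda>i. if i = 0 then b' else if i = 1 then b else t i)"
  have Lu: "Lad (2 + n) u = ?M \<diamond> (B N 1 b \<diamond> B N 0 b')"
    unfolding L by (simp add: u_def)
  have B1: "B N 1 b'' = qid 1 \<parallel> B (2 + n) 0 b''"
    by (simp add: N B.simps(2) del: B.simps(1))
  have "D N ?r1 \<diamond> ?S = qid 1 \<parallel> (h1 \<diamond> (h2 \<diamond> (B (2 + n) 0 b'' \<diamond> h3)))"
    unfolding h1(2) h2(2) h3(2) B1 using h1(1) h2(1) h3(1) by (simp add: interchange del: B.simps)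
  then have "B N 0 s \<diamond> (D N ?P \<diamond> Lad (2 + n) t)
     = (D N ?g1 \<diamond> Lad (2 + n) u) \<diamond> (qid 1 \<parallel> (h1 \<diamond> (h2 \<diamond> (B (2 + n) 0 b'' \<diamond> h3))))"
    unfolding 3 Lu using h1(1) h2(1) h3(1) by (simp add: qseq_assoc M N del: B.simps D.simps)
  moreover have "NF (2 + n) (D N ?g1 \<diamond> Lad (2 + n) u)"
    using NF_Lad[of "2 + n" ?g1 u] by (simp only: N(2))
  ultimately show ?thesis
    using NF_stab h1(1) h2(1) h3(1) by simp
qed

text \<open>For \<open>k = 0\<close> the axioms (F) and (G) apply, depending on the number of modes.
  For larger \<open>k\<close> the new gates lie below mode 0, so the induction hypothesis applies to
  the staircase without its first beam splitter.\<close>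

lemma NF_B_single: "NF m (B (Suc m) k s \<diamond> (D (Suc m) (single k a) \<diamond> Lad m t))"
proof (induction k arbitrary: m t)
  case 0
  have "m = 0 \<or> m = 1 \<or> (\<exists>n. m = 2 + n)" by presburger
  then consider "m = 0" | "m = 1" | n where "m = 2 + n" by blast
  then show ?case
  proof cases
    case 1
    then show ?thesis using NF_Lad[of 0] by (simp add: B_oob del: D.simps)
  next
    case 2
    then show ?thesis using NF_B0_two by (simp add: numeral_2_eq_2 del: B.simps D.simps Lad.simps)
  next
    case 3
    then show ?thesis using NF_B0_many[of n] by (simp add: numeral_3_eq_3 del: B.simps D.simps Lad.simps)
  qed
next
  case (Suc k)
  show ?case
  proof (cases m)
    case 0
    then show ?thesis using NF_Lad[of 0] by (simp add: B_oob del: D.simps B.simps)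
  next
    case m: (Suc m')
    let ?N = "Suc (Suc m')"
    let ?y = "B (Suc m') k s \<diamond> (D (Suc m') (single k a) \<diamond> Lad m' (\<lambda>i. t (Suc i)))"
    obtain f u h where h: "qar h = m'" and y: "?y = D (Suc m') f \<diamond> (Lad m' u \<diamond> (qid 1 \<parallel> h))"
      using Suc.IH[of m' "\<lambda>i. t (Suc i)"] by (auto simp: NF_def)
    have "D ?N (single (Suc k) a) = qid 1 \<parallel> D (Suc m') (single k a)"
      by (subst D_fix0) simp_all
    then have "B ?N (Suc k) s \<diamond> (D ?N (single (Suc k) a) \<diamond> Lad (Suc m') t) = (qid 1 \<parallel> ?y) \<diamond> B ?N 0 (t 0)"
      by (simp add: interchange B.simps(2) flip: qseq_assoc del: D.simps B.simps(1))
    also have "\<dots> = (qid 1 \<parallel> D (Suc m') f) \<diamond> ((qid 1 \<parallel> Lad m' u) \<diamond> ((qid 1 \<parallel> (qid 1 \<parallel> h)) \<diamond> B ?N 0 (t 0)))"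
      unfolding y using h by (simp add: interchange flip: qseq_assoc del: D.simps B.simps)
    \<comment> \<open>The remainder from the induction hypothesis acts on modes 2 and below, so it
      passes the beam splitter on modes 0 and 1.\<close>
    also have "(qid 1 \<parallel> (qid 1 \<parallel> h)) \<diamond> B ?N 0 (t 0) = B ?N 0 (t 0) \<diamond> (qid 1 \<parallel> (qid 1 \<parallel> h))"
      using h by (simp add: interchange qid_add flip: qpar_assoc numeral_2_eq_2)
    also have "(qid 1 \<parallel> D (Suc m') f) \<diamond> ((qid 1 \<parallel> Lad m' u) \<diamond> (B ?N 0 (t 0) \<diamond> (qid 1 \<parallel> (qid 1 \<parallel> h))))
        = D ?N (case_nat 0 f) \<diamond> (Lad (Suc m') (case_nat (t 0) u) \<diamond> (qid 1 \<parallel> (qid 1 \<parallel> h)))"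
      using h by (simp add: qseq_assoc flip: D_shift del: D.simps B.simps)
    finally show ?thesis
      unfolding NF_def m using h
      by (intro exI[of _ "case_nat 0 f"] exI[of _ "case_nat (t 0) u"] exI[of _ "qid 1 \<parallel> h"]) simp
  qed
qed

text \<open>The phase layer is factored so that one part, \<open>f'\<close>, agrees on modes
  \<open>k\<close> and \<open>Suc k\<close> and passes the beam splitter by (E). What remains is a
  single phase on mode \<open>k\<close>, the case of \<open>NF_B_single\<close>.\<close>

lemma NF_B:
  assumes "NF m x"
  shows "NF m (B (Suc m) k s \<diamond> x)"
proof -
  let ?N = "Suc m"
  obtain f t h where h: "qar h = m" and x: "x = D ?N f \<diamond> (Lad m t \<diamond> (qid 1 \<parallel> h))"
    using assms by (auto simp: NF_def)
  define f' where "f' = f(k := f (Suc k))"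
  have D: "D ?N f = D ?N f' \<diamond> D ?N (single k (f k - f (Suc k)))"
    unfolding D_mult by (rule D_cong) (auto simp: f'_def)
  have "B ?N k s \<diamond> x
      = B ?N k s \<diamond> (D ?N f' \<diamond> (D ?N (single k (f k - f (Suc k))) \<diamond> (Lad m t \<diamond> (qid 1 \<parallel> h))))"
    unfolding x D using h by (simp add: qseq_assoc del: D.simps)
  also have "\<dots> = D ?N f' \<diamond> (B ?N k s \<diamond> (D ?N (single k (f k - f (Suc k))) \<diamond> (Lad m t \<diamond> (qid 1 \<parallel> h))))"
    using h by (intro commute_left B_D_commute) (simp_all add: f'_def del: D.simps)
  also have "\<dots> = D ?N f' \<diamond> ((B ?N k s \<diamond> (D ?N (single k (f k - f (Suc k))) \<diamond> Lad m t)) \<diamond> (qid 1 \<parallel> h))"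
    using h by (simp add: qseq_assoc del: D.simps)
  finally show ?thesis
    using NF_D[OF NF_stab[OF NF_B_single h]] by metis
qed

lemma NF_all:
  assumes "qar x = Suc m"
  shows "NF m x"
proof -
  have "gen (Suc m) x" using gen_all[of x] assms by simp
  then show ?thesis
    by induction (rule NF_id NF_D NF_B, assumption?)+
qed

section \<open>Faithfulness of the semantics\<close>

lemma qsem_seq: "qar x = qar y \<Longrightarrow> qsem (x \<diamond> y) = qsem x * qsem y"
  by transfer simp

lemma qsem_par: "qsem (x \<parallel> y) = dsum (qsem x) (qsem y)"
  by transfer (rule sem_Par)

lemma qsem_qid [simp]: "qsem (qid n) = 1\<^sub>m n"
  by transfer simp

lemma qsem_qph: "qsem (qph p) = sem (Ph p)"
  by transfer simp

lemma qsem_qbs: "qsem (qbs p) = sem (Bs p)"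
  by transfer simp

lemma qsem_carrier: "qar x = n \<Longrightarrow> qsem x \<in> carrier_mat n n"
  by transfer (auto simp: lopp_self_iff sem_carrier)

lemma qsem_dim [simp]: "dim_row (qsem x) = qar x" "dim_col (qsem x) = qar x"
  using qsem_carrier[of x "qar x"] by auto

section \<open>Top left entries of composites\<close>

lemma dsum_1_mult_entry:
  assumes "A \<in> carrier_mat 1 1" "Y \<in> carrier_mat n n" "M \<in> carrier_mat (Suc n) (Suc n)"
  shows "(dsum A Y * M) $$ (0, 0) = A $$ (0, 0) * M $$ (0, 0)"
proof -
  have "(dsum A Y * M) $$ (0, 0) = (\<Sum>i<Suc n. dsum A Y $$ (0, i) * M $$ (i, 0))"
    using assms by (simp add: scalar_prod_def atLeast0LessThan)
  also have "\<dots> = A $$ (0, 0) * M $$ (0, 0)"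
    using assms by (subst sum.lessThan_Suc_shift) (simp add: dsum_index)
  finally show ?thesis .
qed

lemma mult_dsum_1_entry:
  assumes "A \<in> carrier_mat 1 1" "Y \<in> carrier_mat n n" "M \<in> carrier_mat (Suc n) (Suc n)"
  shows "(M * dsum A Y) $$ (0, 0) = M $$ (0, 0) * A $$ (0, 0)"
proof -
  have "(M * dsum A Y) $$ (0, 0) = (\<Sum>i<Suc n. M $$ (0, i) * dsum A Y $$ (i, 0))"
    using assms by (simp add: scalar_prod_def atLeast0LessThan)
  also have "\<dots> = M $$ (0, 0) * A $$ (0, 0)"
    using assms by (subst sum.lessThan_Suc_shift) (simp add: dsum_index)
  finally show ?thesis .
qed

lemma qsem_par_seq_entry:
  assumes "qar x = 1" "qar y = n" "qar z = Suc n"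
  shows "qsem ((x \<parallel> y) \<diamond> z) $$ (0, 0) = qsem x $$ (0, 0) * qsem z $$ (0, 0)"
  using assms by (simp add: qsem_seq qsem_par del: index_mult_mat)
    (intro dsum_1_mult_entry, auto intro: qsem_carrier)

lemma qsem_seq_par_entry:
  assumes "qar x = 1" "qar y = n" "qar z = Suc n"
  shows "qsem (z \<diamond> (x \<parallel> y)) $$ (0, 0) = qsem z $$ (0, 0) * qsem x $$ (0, 0)"
  using assms by (simp add: qsem_seq qsem_par del: index_mult_mat)
    (intro mult_dsum_1_entry, auto intro: qsem_carrier)

lemma qar_0: "qar x = 0 \<Longrightarrow> x = qid 0"
proof -
  assume "qar x = 0"
  then have "gen 0 x" using gen_all[of x] by simp
  then show ?thesis
    by induction auto
qed

text \<open>Mode 0 meets only the first beam splitter of the staircase, if there is one.\<close>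

lemma Lad_entry:
  "qsem (Lad m t) $$ (0, 0) = (if m = 0 then 1 else of_real (cos (t 0)))"
proof (cases m)
  case (Suc n)
  have "qsem (Lad (Suc n) t) $$ (0, 0) = qsem (qid 1) $$ (0, 0) * qsem (B (Suc (Suc n)) 0 (t 0)) $$ (0, 0)"
    unfolding Lad.simps by (rule qsem_par_seq_entry[of _ _ "Suc n"]) simp_all
  then show ?thesis
    using Suc by (simp add: qsem_par qsem_qbs dsum_index)
qed simp

text \<open>A diagonal first beam splitter is a pair of equal phases \<open>c\<close>. It factors
  into \<open>c\<close> on all modes, which commutes with the rest of the staircase, and a layer
  that is trivial on mode 0.\<close>

lemma Lad_reduce:
  assumes "sin (t 0) = 0" "0 < m"
  obtains c h where "cis c = of_real (cos (t 0))" "qar h = m"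
    "Lad m t = D (Suc m) (\<lambda>_. c) \<diamond> (qid 1 \<parallel> h)"
proof -
  obtain n where m: "m = Suc n" using assms(2) by (cases m) auto
  obtain c where c: "cis c = of_real (cos (t 0))" "qbs (t 0) = qph c \<parallel> qph c"
    using qbs_diagonal[OF assms(1)] by metis
  let ?N = "Suc (Suc n)" and ?f = "\<lambda>i::nat. if i < 2 then c else 0"
  let ?L = "qid 1 \<parallel> Lad n (\<lambda>i. t (Suc i))"
  have "D n (\<lambda>i. ?f (Suc (Suc i))) = qid n"
    by (rule D_one) simp
  then have "B ?N 0 (t 0) = D ?N ?f"
    by (simp add: c(2) qpar_assoc)
  also have "\<dots> = D ?N (\<lambda>_. c) \<diamond> D ?N (\<lambda>i. ?f i - c)"
    unfolding D_mult by (rule D_cong) simp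
  also have "D ?N (\<lambda>i. ?f i - c) = qid 1 \<parallel> D (Suc n) (\<lambda>i. ?f (Suc i) - c)"
    by (rule D_fix0) simp
  finally have "Lad m t = ?L \<diamond> (D ?N (\<lambda>_. c) \<diamond> (qid 1 \<parallel> D (Suc n) (\<lambda>i. ?f (Suc i) - c)))"
    unfolding m by simp
  also have "\<dots> = D ?N (\<lambda>_. c) \<diamond> (?L \<diamond> (qid 1 \<parallel> D (Suc n) (\<lambda>i. ?f (Suc i) - c)))"
  proof (rule commute_left)
    show "?L \<diamond> D ?N (\<lambda>_. c) = D ?N (\<lambda>_. c) \<diamond> ?L"
      by (subst (1 2) D.simps(2)) (simp add: interchange Lad_const_commute del: D.simps)
  qed (simp_all del: D.simps)
  also have "?L \<diamond> (qid 1 \<parallel> D (Suc n) (\<lambda>i. ?f (Suc i) - c))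
      = qid 1 \<parallel> (Lad n (\<lambda>i. t (Suc i)) \<diamond> D (Suc n) (\<lambda>i. ?f (Suc i) - c))"
    by (rule seq_shift[symmetric]) simp
  finally show ?thesis
    using that[of c "Lad n (\<lambda>i. t (Suc i)) \<diamond> D (Suc n) (\<lambda>i. ?f (Suc i) - c)"] c(1) m by simp
qed

text \<open>The corner entry of the normal form is a phase times the corner of the staircase. As it
  equals 1, the first cosine has absolute value 1, so the staircase reduces and the total phase on
  mode 0 is trivial.\<close>

lemma qsem_one_imp_stab:
  assumes "qar x = Suc m" "qsem x = 1\<^sub>m (Suc m)"
  obtains y where "qar y = m" "x = qid 1 \<parallel> y"
proof -
  obtain f t h where h: "qar h = m" and x: "x = D (Suc m) f \<diamond> (Lad m t \<diamond> (qid 1 \<parallel> h))"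
    using NF_all[OF assms(1)] by (auto simp: NF_def)
  have "qsem x $$ (0, 0) = qsem (qph (f 0)) $$ (0, 0) * qsem (Lad m t \<diamond> (qid 1 \<parallel> h)) $$ (0, 0)"
    unfolding x D.simps(2) by (rule qsem_par_seq_entry[of _ _ m]) (simp_all add: h)
  also have "qsem (Lad m t \<diamond> (qid 1 \<parallel> h)) $$ (0, 0) = qsem (Lad m t) $$ (0, 0) * qsem (qid 1) $$ (0, 0)"
    by (rule qsem_seq_par_entry[of _ _ m]) (simp_all add: h)
  finally have e: "cis (f 0) * qsem (Lad m t) $$ (0, 0) = 1"
    using assms(2) by (simp add: qsem_qph)
  \<comment> \<open>For \<open>m = 0\<close> the staircase is a single wire and \<open>c = 0\<close>
    works; otherwise \<open>Lad_reduce\<close> gives \<open>c\<close>.\<close>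
  have "\<exists>c h'. cis c = qsem (Lad m t) $$ (0, 0) \<and> qar h' = m \<and>
      Lad m t = D (Suc m) (\<lambda>_. c) \<diamond> (qid 1 \<parallel> h')"
  proof (cases "m = 0")
    case True
    then show ?thesis
      using qph_0 by (intro exI[of _ 0] exI[of _ "qid 0"]) (simp add: Lad_entry)
  next
    case False
    then have "cmod (cis (f 0) * of_real (cos (t 0))) = 1"
      using e by (simp add: Lad_entry)
    then have "\<bar>cos (t 0)\<bar> = 1" by (simp add: norm_mult)
    then have "sin (t 0) = 0"
      using sin_cos_squared_add[of "t 0"] by (simp flip: abs_square_eq_1)
    then show ?thesis
      using Lad_reduce[of t m] False by (simp only: Lad_entry) (metis gr0I)
  qed
  then obtain c h' where c: "cis c = qsem (Lad m t) $$ (0, 0)" and h': "qar h' = m"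
    and L: "Lad m t = D (Suc m) (\<lambda>_. c) \<diamond> (qid 1 \<parallel> h')" by blast
  have "cis (f 0 + c) = 1" using e c by (simp flip: cis_mult)
  then have "qph (f 0 + c) = qid 1" by (rule qph_cis1)
  then have D: "D (Suc m) (\<lambda>i. f i + c) = qid 1 \<parallel> D m (\<lambda>i. f (Suc i) + c)" by simp
  have "x = D (Suc m) (\<lambda>i. f i + c) \<diamond> ((qid 1 \<parallel> h') \<diamond> (qid 1 \<parallel> h))"
    unfolding x L using h h' by (simp add: qseq_assoc D_mult_left del: D.simps)
  also have "\<dots> = qid 1 \<parallel> (D m (\<lambda>i. f (Suc i) + c) \<diamond> (h' \<diamond> h))"
    unfolding D using h h' by (simp add: interchange)
  finally show ?thesis
    using that[of "D m (\<lambda>i. f (Suc i) + c) \<diamond> (h' \<diamond> h)"] h h' by simp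
qed

lemma qsem_one_imp_id: "qar x = n \<Longrightarrow> qsem x = 1\<^sub>m n \<Longrightarrow> x = qid n"
proof (induction n arbitrary: x)
  case 0
  then show ?case by (intro qar_0)
next
  case (Suc n)
  obtain y where y: "qar y = n" "x = qid 1 \<parallel> y"
    using qsem_one_imp_stab[OF Suc.prems] by metis
  have "dsum (1\<^sub>m 1) (qsem y) = dsum (1\<^sub>m 1) (1\<^sub>m n)"
    using Suc.prems(2) by (simp add: y(2) qsem_par)
  then have "qsem y = 1\<^sub>m n"
    by (rule dsum_right_inject) (simp_all add: y(1))
  then have "y = qid n" using Suc.IH y(1) by blast
  then show ?case using y(2) by (simp add: qid_add)
qed

text \<open>Phase layers and beam splitters are inverted by negating their angles, and inverses of
  words are composed in reverse order.\<close>

lemma inverse_exists: "gen n x \<Longrightarrow> \<exists>y. qar y = n \<and> y \<diamond> x = qid n \<and> x \<diamond> y = qid n"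
proof (induction rule: gen.induct)
  case gen_id
  then show ?case by (intro exI[of _ "qid n"]) simp
next
  have step: "\<exists>y. qar y = n \<and> y \<diamond> (g \<diamond> x) = qid n \<and> (g \<diamond> x) \<diamond> y = qid n"
    if g: "qar g = n" "qar g' = n" "g' \<diamond> g = qid n" "g \<diamond> g' = qid n" and x: "gen n x"
      and IH: "\<exists>y. qar y = n \<and> y \<diamond> x = qid n \<and> x \<diamond> y = qid n" for g g' x
  proof -
    obtain y where y: "qar y = n" "y \<diamond> x = qid n" "x \<diamond> y = qid n" using IH by blast
    note q = gen_qar[OF x]
    have "(y \<diamond> g') \<diamond> (g \<diamond> x) = y \<diamond> ((g' \<diamond> g) \<diamond> x)"
      using g(1,2) y(1) q by (simp add: qseq_assoc)
    then have 1: "(y \<diamond> g') \<diamond> (g \<diamond> x) = qid n" using g(3) y(2) q by simp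
    have "(g \<diamond> x) \<diamond> (y \<diamond> g') = g \<diamond> ((x \<diamond> y) \<diamond> g')"
      using g(1,2) y(1) q by (simp add: qseq_assoc)
    then have 2: "(g \<diamond> x) \<diamond> (y \<diamond> g') = qid n" using g(2,4) y(3) by simp
    show ?thesis using 1 2 g(2) y(1) by (intro exI[of _ "y \<diamond> g'"]) simp
  qed
  {
    case (gen_D x f)
    have "D n (\<lambda>i. - f i) \<diamond> D n f = qid n" "D n f \<diamond> D n (\<lambda>i. - f i) = qid n"
      unfolding D_mult by (rule D_one, simp)+
    then show ?case using gen_D by (intro step[of _ "D n (\<lambda>i. - f i)"]) simp_all
  next
    case (gen_B x k t)
    show ?case
      using gen_B B_inverse[of n k t] B_inverse[of n k "- t"]
      by (intro step[of _ "B n k (- t)"]) simp_all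
  }
qed

text \<open>Composition with an inverse of \<open>z\<close> reduces the claim to a circuit whose
  semantics is the identity.\<close>

lemma qsem_inject:
  assumes "qar x = qar z" "qsem x = qsem z"
  shows "x = z"
proof -
  let ?n = "qar z"
  obtain y where y: "qar y = ?n" "y \<diamond> z = qid ?n" "z \<diamond> y = qid ?n"
    using inverse_exists[OF gen_all[of z]] by blast
  have "qsem (x \<diamond> y) = qsem (z \<diamond> y)"
    using assms y(1) by (simp add: qsem_seq)
  then have "x \<diamond> y = qid ?n"
    using assms(1) y by (intro qsem_one_imp_id) simp_all
  then have "(x \<diamond> y) \<diamond> z = z" by simp
  moreover have "(x \<diamond> y) \<diamond> z = x \<diamond> (y \<diamond> z)"
    using assms(1) y(1) by (intro qseq_assoc) simp_all
  ultimately show ?thesis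
    using y(2) assms(1) by simp
qed

theorem mainTheorem1:
  assumes "wf C1" and "wf C2" and "ar C1 = n" and "ar C2 = n"
  shows "lopp C1 C2 \<longleftrightarrow> sem C1 = sem C2"
proof
  assume "sem C1 = sem C2"
  then have "cls C1 = cls C2"
    using assms by (intro qsem_inject) (simp_all add: qar_cls qsem_cls)
  then show "lopp C1 C2"
    using assms cls_eq_iff by blast
qed (rule lopp_sound)

end
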